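(* Let $K$ be a field, let $r \ge 1$ be an integer, let $R = K[x_{i,j} : 1 \le i \le r,\ j \in \mathbf{N}]$, and let $I \subset R$ be a homogeneous ideal that is stable under the action of the infinite symmetric group $S_\infty$ on $R$. Then the Hilbert series $H_I(s,t) = \sum_{n \ge 0} H_{I_n}(t)\, s^n$ is a rational function of $s$ and $t$.
   Context: $\mathbf{N}$ is the set of non-negative integers. $S_\infty$ is the infinite symmetric group of permutations of $\mathbf{N}$; it acts on $R$ by $K$-algebra automorphisms via $\sigma \cdot x_{i,j} = x_{i,\sigma(j)}$ (whether one takes all permutations or only the finitely supported ones does not affect which ideals are stable). $R$ is graded by total degree, each $x_{i,j}$ having degree $1$. For $n \ge 0$, $R_n \subset R$ is the subalgebra generated by the variables $x_{i,j}$ with $1 \le i \le r$ and $0 \le j \le n$, and $I_n = I \cap R_n$. $H_{I_n}(t) = \sum_{d \ge 0} \dim_K\big((I_n)_d\big)\, t^d$ is the usual Hilbert series, where $(I_n)_d$ is the degree-$d$ part. $H_I(s,t)$ is regarded as a formal power series in $s,t$ with integer coefficients; it is a rational function if there are polynomials $P, Q$ in $s,t$ with $Q \neq 0$ and $Q \cdot H_I = P$ as power series. *)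

theory Defs
  imports
    "HOL-Library.Poly_Mapping"
    "HOL-Computational_Algebra.Polynomial_FPS"
    "HOL-Algebra.Ideal"
begin

section \<open>The ring of polynomials in the variables \<open>x\<^sub>i\<^sub>,\<^sub>j\<close>\<close>

text \<open>
  The pair \<open>(i, j)\<close> stands for the variable \<open>x\<^sub>i\<^sub>,\<^sub>j\<close>; a monomial is a finitely supported
  exponent function and a polynomial a finitely supported coefficient function on monomials.
  The ring operations on polynomials are the (convolution) type class operations of
  \<open>Poly_Mapping\<close>.
\<close>

type_synonym var = "nat \<times> nat"
type_synonym monom = "var \<Rightarrow>\<^sub>0 nat"
type_synonym 'k mpoly = "monom \<Rightarrow>\<^sub>0 'k"

definition Const :: "'k::field \<Rightarrow> 'k mpoly" where
  "Const c = Poly_Mapping.single 0 c"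

definition Var :: "nat \<Rightarrow> nat \<Rightarrow> 'k::field mpoly" where
  "Var i j = Poly_Mapping.single (Poly_Mapping.single (i, j) 1) 1"

definition polys :: "var set \<Rightarrow> 'k::field mpoly set" where
  "polys V = {p. \<forall>m \<in> Poly_Mapping.keys p. Poly_Mapping.keys m \<subseteq> V}"

definition mpoly_ring :: "nat \<Rightarrow> 'k::field mpoly ring" where
  "mpoly_ring r =
    \<lparr>carrier = polys ({1..r} \<times> UNIV), mult = (*), one = 1, zero = 0, add = (+)\<rparr>"

definition truncation :: "nat \<Rightarrow> nat \<Rightarrow> 'k::field mpoly set" where
  "truncation r n = polys ({1..r} \<times> {0..n})"


section \<open>The grading\<close>

definition monom_degree :: "monom \<Rightarrow> nat" where
  "monom_degree m = (\<Sum>v \<in> Poly_Mapping.keys m. Poly_Mapping.lookup m v)"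

definition homogeneous_component :: "nat \<Rightarrow> 'k::field mpoly \<Rightarrow> 'k mpoly" where
  "homogeneous_component d p =
    (\<Sum>m \<in> {m \<in> Poly_Mapping.keys p. monom_degree m = d}.
      Poly_Mapping.single m (Poly_Mapping.lookup p m))"

definition homogeneous_ideal :: "nat \<Rightarrow> 'k::field mpoly set \<Rightarrow> bool" where
  "homogeneous_ideal r I \<longleftrightarrow>
    ideal I (mpoly_ring r) \<and> (\<forall>p \<in> I. \<forall>d. homogeneous_component d p \<in> I)"

definition degree_part :: "nat \<Rightarrow> 'k::field mpoly set \<Rightarrow> 'k mpoly set" where
  "degree_part d S = {p \<in> S. \<forall>m \<in> Poly_Mapping.keys p. monom_degree m = d}"


section \<open>The action of the infinite symmetric group\<close>

definition perm_monom :: "(nat \<Rightarrow> nat) \<Rightarrow> monom \<Rightarrow> monom" where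
  "perm_monom \<sigma> m =
    (\<Sum>v \<in> Poly_Mapping.keys m.
      Poly_Mapping.single (fst v, \<sigma> (snd v)) (Poly_Mapping.lookup m v))"

definition perm_poly :: "(nat \<Rightarrow> nat) \<Rightarrow> 'k::field mpoly \<Rightarrow> 'k mpoly" where
  "perm_poly \<sigma> p =
    (\<Sum>m \<in> Poly_Mapping.keys p.
      Poly_Mapping.single (perm_monom \<sigma> m) (Poly_Mapping.lookup p m))"

definition symmetric_stable :: "'k::field mpoly set \<Rightarrow> bool" where
  "symmetric_stable I \<longleftrightarrow> (\<forall>\<sigma>. bij \<sigma> \<longrightarrow> perm_poly \<sigma> ` I \<subseteq> I)"


section \<open>Hilbert series\<close>

definition mpoly_scale :: "'k::field \<Rightarrow> 'k mpoly \<Rightarrow> 'k mpoly" where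
  "mpoly_scale c p = Const c * p"

definition mpoly_dim :: "'k::field mpoly set \<Rightarrow> nat" where
  "mpoly_dim S = vector_space.dim mpoly_scale S"

definition hilbert_series :: "'k::field mpoly set \<Rightarrow> int fps" where
  "hilbert_series S = Abs_fps (\<lambda>d. int (mpoly_dim (degree_part d S)))"

text \<open>
  Power series in \<open>s, t\<close> are series in \<open>s\<close> whose coefficients are series in \<open>t\<close>,
  and likewise for polynomials.
\<close>

definition equivariant_hilbert_series :: "nat \<Rightarrow> 'k::field mpoly set \<Rightarrow> int fps fps" where
  "equivariant_hilbert_series r I = Abs_fps (\<lambda>n. hilbert_series (I \<inter> truncation r n))"

definition fps_of_poly2 :: "int poly poly \<Rightarrow> int fps fps" where
  "fps_of_poly2 P = fps_of_poly (map_poly fps_of_poly P)"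

definition rational_fps2 :: "int fps fps \<Rightarrow> bool" where
  "rational_fps2 H \<longleftrightarrow>
    (\<exists>P Q :: int poly poly. Q \<noteq> 0 \<and> fps_of_poly2 Q * H = fps_of_poly2 P)"


section \<open>Basic properties\<close>

lemma fps_of_poly2_nth: "fps_nth (fps_nth (fps_of_poly2 P) i) j = coeff (coeff P i) j"
  by (simp add: fps_of_poly2_def coeff_map_poly)

lemma mpoly_eq_sum_single:
  "(\<Sum>m \<in> Poly_Mapping.keys p. Poly_Mapping.single m (Poly_Mapping.lookup p m)) = p"
proof (rule poly_mapping_eqI)
  fix k
  have "Poly_Mapping.lookup
      (\<Sum>m \<in> Poly_Mapping.keys p. Poly_Mapping.single m (Poly_Mapping.lookup p m)) k
    = (\<Sum>m \<in> Poly_Mapping.keys p. if m = k then Poly_Mapping.lookup p m else 0)"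
    by (auto simp: lookup_sum lookup_single when_def intro!: sum.cong)
  also have "\<dots> = Poly_Mapping.lookup p k"
    by (simp add: in_keys_iff)
  finally show "Poly_Mapping.lookup
      (\<Sum>m \<in> Poly_Mapping.keys p. Poly_Mapping.single m (Poly_Mapping.lookup p m)) k
    = Poly_Mapping.lookup p k" .
qed

lemma vector_space_mpoly: "vector_space (mpoly_scale :: 'k::field \<Rightarrow> _)"
proof
  fix a b :: 'k and p q :: "'k mpoly"
  show "mpoly_scale a (p + q) = mpoly_scale a p + mpoly_scale a q"
    by (simp add: mpoly_scale_def distrib_left)
  show "mpoly_scale (a + b) p = mpoly_scale a p + mpoly_scale b p"
    by (simp add: mpoly_scale_def Const_def single_add distrib_right)
  show "mpoly_scale a (mpoly_scale b p) = mpoly_scale (a * b) p"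
    by (simp add: mpoly_scale_def Const_def mult_single flip: mult.assoc)
  show "mpoly_scale 1 p = p"
    by (simp add: mpoly_scale_def Const_def)
qed

lemma zero_in_polys: "0 \<in> polys V"
  by (simp add: polys_def)

lemma Const_in_polys: "Const c \<in> polys V"
  by (simp add: polys_def Const_def)

lemma Var_in_polys: "(i, j) \<in> V \<Longrightarrow> Var i j \<in> polys V"
  by (simp add: polys_def Var_def)

lemma add_in_polys: "p \<in> polys V \<Longrightarrow> q \<in> polys V \<Longrightarrow> p + q \<in> polys V"
  using Poly_Mapping.keys_add[of p q] by (auto simp: polys_def)

lemma uminus_in_polys: "p \<in> polys V \<Longrightarrow> - p \<in> polys V"
  by (auto simp: polys_def in_keys_iff)

lemma mult_in_polys:
  assumes "p \<in> polys V" "q \<in> polys V"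
  shows "p * q \<in> polys V"
  unfolding polys_def
proof (intro CollectI ballI)
  fix m assume "m \<in> Poly_Mapping.keys (p * q)"
  then obtain a b where ab: "a \<in> Poly_Mapping.keys p" "b \<in> Poly_Mapping.keys q" "m = a + b"
    using keys_mult[of p q] by blast
  with assms show "Poly_Mapping.keys m \<subseteq> V"
    using Poly_Mapping.keys_add[of a b] unfolding polys_def by blast
qed

lemma cring_mpoly_ring: "cring (mpoly_ring r :: 'k::field mpoly ring)"
proof (rule cringI)
  show "abelian_group (mpoly_ring r :: 'k mpoly ring)"
  proof (rule abelian_groupI)
    fix p :: "'k mpoly" assume "p \<in> carrier (mpoly_ring r)"
    then show "\<exists>q \<in> carrier (mpoly_ring r). q \<oplus>\<^bsub>mpoly_ring r\<^esub> p = \<zero>\<^bsub>mpoly_ring r\<^esub>"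
      by (intro bexI[of _ "- p"]) (simp_all add: mpoly_ring_def uminus_in_polys)
  qed (simp_all add: mpoly_ring_def add_in_polys zero_in_polys algebra_simps)
  show "Group.comm_monoid (mpoly_ring r :: 'k mpoly ring)"
  proof (rule Group.comm_monoidI)
    show "\<one>\<^bsub>mpoly_ring r\<^esub> \<in> carrier (mpoly_ring r :: 'k mpoly ring)"
      using Const_in_polys[of 1] by (simp add: mpoly_ring_def Const_def)
  qed (simp_all add: mpoly_ring_def mult_in_polys algebra_simps)
qed (simp add: mpoly_ring_def algebra_simps)

text \<open>\<open>polys V\<close> is the subalgebra generated by the variables in \<open>V\<close>.\<close>

lemma single_in_subalgebra:
  assumes C: "\<And>c. Const c \<in> S" and X: "\<And>i j. (i, j) \<in> V \<Longrightarrow> Var i j \<in> S"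
    and M: "\<And>p q. p \<in> S \<Longrightarrow> q \<in> S \<Longrightarrow> p * q \<in> S"
    and "Poly_Mapping.keys m \<subseteq> V"
  shows "Poly_Mapping.single m (c :: 'k::field) \<in> S"
proof -
  have pow: "Poly_Mapping.single (Poly_Mapping.single v e) (1 :: 'k) \<in> S" if "v \<in> V" for v e
  proof (induction e)
    case 0
    then show ?case using C[of 1] by (simp add: Const_def)
  next
    case (Suc e)
    have "Poly_Mapping.single (Poly_Mapping.single v (Suc e)) (1 :: 'k)
        = Var (fst v) (snd v) * Poly_Mapping.single (Poly_Mapping.single v e) 1"
      by (simp add: Var_def mult_single flip: single_add)
    then show ?case using M X[of "fst v" "snd v"] Suc that by simp
  qed
  have "Poly_Mapping.single (\<Sum>v \<in> A. Poly_Mapping.single v (Poly_Mapping.lookup m v)) c \<in> S"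
    if "finite A" "A \<subseteq> V" for A
    using that
  proof (induction A)
    case empty
    then show ?case using C[of c] by (simp add: Const_def)
  next
    case (insert v A)
    have "Poly_Mapping.single
        (\<Sum>v \<in> insert v A. Poly_Mapping.single v (Poly_Mapping.lookup m v)) c
      = Poly_Mapping.single (Poly_Mapping.single v (Poly_Mapping.lookup m v)) 1
        * Poly_Mapping.single (\<Sum>v \<in> A. Poly_Mapping.single v (Poly_Mapping.lookup m v)) c"
      using insert by (simp add: mult_single)
    then show ?case using insert M pow by simp
  qed
  from this[of "Poly_Mapping.keys m"] assms(4) show ?thesis
    by (simp add: mpoly_eq_sum_single)
qed

lemma polys_least:
  assumes C: "\<And>c. Const c \<in> S" and X: "\<And>i j. (i, j) \<in> V \<Longrightarrow> Var i j \<in> S"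
    and A: "\<And>p q. p \<in> S \<Longrightarrow> q \<in> S \<Longrightarrow> p + q \<in> S"
    and M: "\<And>p q. p \<in> S \<Longrightarrow> q \<in> S \<Longrightarrow> p * q \<in> S"
  shows "(polys V :: 'k::field mpoly set) \<subseteq> S"
proof
  fix p :: "'k mpoly" assume p: "p \<in> polys V"
  have "(\<Sum>m \<in> B. Poly_Mapping.single m (Poly_Mapping.lookup p m)) \<in> S"
    if "finite B" "B \<subseteq> Poly_Mapping.keys p" for B
    using that
  proof (induction B)
    case empty
    then show ?case using C[of 0] by (simp add: Const_def)
  next
    case (insert m B)
    then have "Poly_Mapping.keys m \<subseteq> V" using p by (auto simp: polys_def)
    then have "Poly_Mapping.single m (Poly_Mapping.lookup p m) \<in> S"
      by (intro single_in_subalgebra[OF C X M])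
    then show ?case using insert A by simp
  qed
  from this[of "Poly_Mapping.keys p"] show "p \<in> S" by (simp add: mpoly_eq_sum_single)
qed

text \<open>\<open>perm_poly \<sigma>\<close> is the algebra endomorphism that sends \<open>x\<^sub>i\<^sub>,\<^sub>j\<close> to \<open>x\<^sub>i\<^sub>,\<^sub>\<sigma>\<^sub>(\<^sub>j\<^sub>)\<close>.\<close>

lemma perm_monom_superset:
  assumes "finite A" "Poly_Mapping.keys m \<subseteq> A"
  shows "perm_monom \<sigma> m =
    (\<Sum>v \<in> A. Poly_Mapping.single (fst v, \<sigma> (snd v)) (Poly_Mapping.lookup m v))"
  unfolding perm_monom_def using assms
  by (intro sum.mono_neutral_left) (auto simp: in_keys_iff)

lemma perm_monom_single:
  "perm_monom \<sigma> (Poly_Mapping.single v e) = Poly_Mapping.single (fst v, \<sigma> (snd v)) e"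
  by (subst perm_monom_superset[of "{v}"]) (simp_all)

lemma perm_monom_add: "perm_monom \<sigma> (m + m') = perm_monom \<sigma> m + perm_monom \<sigma> m'"
proof -
  let ?A = "Poly_Mapping.keys m \<union> Poly_Mapping.keys m'"
  show ?thesis
    using Poly_Mapping.keys_add[of m m']
    by (simp add: perm_monom_superset[of ?A] lookup_add single_add sum.distrib)
qed

lemma perm_poly_superset:
  assumes "finite A" "Poly_Mapping.keys p \<subseteq> A"
  shows "perm_poly \<sigma> p =
    (\<Sum>m \<in> A. Poly_Mapping.single (perm_monom \<sigma> m) (Poly_Mapping.lookup p m))"
  unfolding perm_poly_def using assms
  by (intro sum.mono_neutral_left) (auto simp: in_keys_iff)

lemma perm_poly_single:
  "perm_poly \<sigma> (Poly_Mapping.single m c) = Poly_Mapping.single (perm_monom \<sigma> m) c"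
  by (subst perm_poly_superset[of "{m}"]) simp_all

lemma perm_poly_Const: "perm_poly \<sigma> (Const c) = Const c"
  by (simp add: Const_def perm_poly_single) (simp add: perm_monom_def)

lemma perm_poly_Var: "perm_poly \<sigma> (Var i j) = Var i (\<sigma> j)"
  by (simp add: Var_def perm_poly_single perm_monom_single)

lemma perm_poly_add: "perm_poly \<sigma> (p + q) = perm_poly \<sigma> p + perm_poly \<sigma> q"
proof -
  let ?A = "Poly_Mapping.keys p \<union> Poly_Mapping.keys q"
  show ?thesis
    using Poly_Mapping.keys_add[of p q]
    by (simp add: perm_poly_superset[of ?A] lookup_add single_add sum.distrib)
qed

lemma perm_poly_sum: "perm_poly \<sigma> (sum f A) = (\<Sum>a \<in> A. perm_poly \<sigma> (f a))"
  by (induction A rule: infinite_finite_induct)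
    (simp_all add: perm_poly_add, simp_all add: perm_poly_def)

lemma perm_poly_mult: "perm_poly \<sigma> (p * q) = perm_poly \<sigma> p * perm_poly \<sigma> q"
proof -
  let ?s = "\<lambda>p m. Poly_Mapping.single m (Poly_Mapping.lookup p m)"
  have "p * q = (\<Sum>m \<in> Poly_Mapping.keys p. ?s p m) * (\<Sum>m' \<in> Poly_Mapping.keys q. ?s q m')"
    by (simp add: mpoly_eq_sum_single)
  also have "\<dots> = (\<Sum>m \<in> Poly_Mapping.keys p. \<Sum>m' \<in> Poly_Mapping.keys q. ?s p m * ?s q m')"
    by (simp add: sum_product)
  finally have "perm_poly \<sigma> (p * q) =
      (\<Sum>m \<in> Poly_Mapping.keys p. \<Sum>m' \<in> Poly_Mapping.keys q. perm_poly \<sigma> (?s p m * ?s q m'))"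
    by (simp add: perm_poly_sum)
  also have "\<dots> = perm_poly \<sigma> p * perm_poly \<sigma> q"
    by (simp add: perm_poly_def[of \<sigma> p] perm_poly_def[of \<sigma> q] sum_product mult_single
        perm_poly_single perm_monom_add)
  finally show ?thesis .
qed

text \<open>
  \<open>vector_space.dim\<close> is 0 on infinite-dimensional spaces; the following shows that this
  case does not arise in the Hilbert series.
\<close>

lemma finite_monoms_of_degree:
  assumes "finite V"
  shows "finite {m :: monom. Poly_Mapping.keys m \<subseteq> V \<and> monom_degree m = d}" (is "finite ?M")
proof (rule finite_imageD)
  show "inj_on Poly_Mapping.lookup ?M"
    by (rule inj_onI) (simp only: poly_mapping.lookup_inject)
  let ?F = "{f :: var \<Rightarrow> nat. \<forall>v. (v \<in> V \<longrightarrow> f v \<in> {0..d}) \<and> (v \<notin> V \<longrightarrow> f v = 0)}"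
  have le: "Poly_Mapping.lookup m v \<le> monom_degree m" for m v
  proof (cases "v \<in> Poly_Mapping.keys m")
    case True
    then show ?thesis
      unfolding monom_degree_def by (intro member_le_sum) simp_all
  qed (simp add: in_keys_iff)
  have "Poly_Mapping.lookup m \<in> ?F" if "m \<in> ?M" for m
  proof (intro CollectI allI conjI impI)
    show "Poly_Mapping.lookup m v \<in> {0..d}" for v
      using le[of m v] that by simp
    show "Poly_Mapping.lookup m v = 0" if "v \<notin> V" for v
    proof -
      have "v \<notin> Poly_Mapping.keys m" using \<open>m \<in> ?M\<close> that by blast
      then show ?thesis by (simp add: in_keys_iff)
    qed
  qed
  then have "Poly_Mapping.lookup ` ?M \<subseteq> ?F" by (rule image_subsetI)
  moreover have "finite ?F"
    using assms by (intro finite_set_of_finite_funs) simp_all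
  ultimately show "finite (Poly_Mapping.lookup ` ?M)"
    by (rule finite_subset)
qed

lemma degree_part_truncation_finite_span:
  "\<exists>B. finite B \<and>
    degree_part d (I \<inter> truncation r n) \<subseteq> module.span mpoly_scale (B :: 'k::field mpoly set)"
proof -
  interpret vector_space "mpoly_scale :: 'k \<Rightarrow> _" by (rule vector_space_mpoly)
  let ?M = "{m :: monom. Poly_Mapping.keys m \<subseteq> {1..r} \<times> {0..n} \<and> monom_degree m = d}"
  let ?B = "(\<lambda>m. Poly_Mapping.single m (1 :: 'k)) ` ?M"
  have "p \<in> span ?B" if p: "p \<in> degree_part d (I \<inter> truncation r n)" for p
  proof -
    have "mpoly_scale (Poly_Mapping.lookup p m) (Poly_Mapping.single m 1) \<in> span ?B"
      if "m \<in> Poly_Mapping.keys p" for m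
    proof (intro span_scale span_base imageI CollectI conjI)
      show "Poly_Mapping.keys m \<subseteq> {1..r} \<times> {0..n}"
        using p that unfolding degree_part_def truncation_def polys_def by blast
      show "monom_degree m = d"
        using p that unfolding degree_part_def by blast
    qed
    then have "(\<Sum>m \<in> Poly_Mapping.keys p.
        mpoly_scale (Poly_Mapping.lookup p m) (Poly_Mapping.single m 1)) \<in> span ?B"
      by (rule span_sum)
    then show ?thesis
      by (simp only: mpoly_scale_def Const_def mult_single mpoly_eq_sum_single
          add_0_left mult_1_right)
  qed
  then have "degree_part d (I \<inter> truncation r n) \<subseteq> span ?B" by (rule subsetI)
  moreover have "finite ?B"
    by (intro finite_imageI finite_monoms_of_degree finite_cartesian_product) simp_all
  ultimately show ?thesis by (intro exI conjI)
qed

end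

theory Submission
  imports
    Defs
    "HOL-Library.Sublist"
    "HOL-Library.Product_Lexorder"
begin

text \<open>
  Gaussian elimination with respect to a monomial order turns the dimension of the degree \<open>d\<close>
  part of \<open>I\<^sub>n\<close> into the number of leading monomials of degree \<open>d\<close> of elements of \<open>I\<^sub>n\<close>
  (\<open>mpoly_dim_degree_part\<close>).  A monomial in the columns \<open>0, \<dots>, n\<close> is the same as a word of
  length \<open>n + 1\<close> whose letters are the exponent vectors of the columns, elements of
  \<open>\<nat>\<^sup>r\<close>.  If \<open>f \<in> I\<close> has leading monomial \<open>m\<close>, and \<open>\<sigma>\<close> is a permutation that is increasing on the
  columns of \<open>f\<close>, then \<open>\<sigma> f \<in> I\<close> has leading monomial \<open>\<sigma> m\<close>, and multiplication by
  monomials enlarges letters.  Hence the set \<open>W\<close> of words of leading monomials is closed upwards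
  under the Higman order: \<open>w \<le> v\<close> if some subword of \<open>v\<close> dominates \<open>w\<close> letter by letter
  (\<open>leads_word_upward\<close>).  It remains to show that every upward closed set of words has a rational
  generating function \<open>H(W)\<close> in \<open>s\<close> (marking length) and \<open>t\<close> (marking degree), which is
  \<open>rational_config_gf\<close>.

  By the lemmas of Dickson and Higman, upward closed sets satisfy the ascending chain condition,
  so this can be proved by induction on \<open>W\<close> from larger to smaller sets.  Splitting off the first
  letter \<open>a\<close> of a word gives
  \<open>H(W) = [\<epsilon> \<in> W] + s \<Sum>\<^sub>a t\<^bsup>|a|\<^esup> H(a\<inverse>W)\<close>, where each quotient
  \<open>a\<inverse>W = {w. a w \<in> W}\<close> is upward closed and contains \<open>W\<close>.
  A quotient that is strictly larger has a rational series by induction, and each of the others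
  contributes a multiple of \<open>H(W)\<close>.  So the sum over \<open>a\<close> is \<open>A + B H(W)\<close>,
  with \<open>A\<close> and \<open>B\<close> rational once the infinite sum is under control, and
  \<open>(1 - s B) H(W) = [\<epsilon> \<in> W] + s A\<close> can be solved because \<open>1 - s B\<close> has constant term 1 in \<open>s\<close>.

  To control the infinite sum over \<open>a \<in> \<nat>\<^sup>r\<close>, the letter is read one unit at a time.  A set \<open>U\<close>
  of pairs (unread part \<open>a\<close> of a letter, rest of the word) satisfies
  \<open>H(U) = H(U\<^sub>0) + t H(U')\<close>, where \<open>U\<^sub>0\<close> collects the pairs in which the first entry of \<open>a\<close> is
  \<open>0\<close>, with that entry removed, and \<open>U'\<close> those in which it is positive, with that entry lowered by
  1.  Again \<open>U \<subseteq> U'\<close>, and the case \<open>U = U'\<close> is a geometric series, so a second induction along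
  the ascending chain condition applies (\<open>affine_in_config_gf\<close>).
\<close>

section \<open>Well-quasi-orders and the ascending chain condition\<close>

text \<open>
  For transitive reflexive \<open>P\<close> this says that \<open>P\<close> is a well-quasi-order on \<open>A\<close>.
\<close>

definition almost_full_on :: "('a \<Rightarrow> 'a \<Rightarrow> bool) \<Rightarrow> 'a set \<Rightarrow> bool" where
  "almost_full_on P A \<longleftrightarrow> (\<forall>f :: nat \<Rightarrow> 'a. range f \<subseteq> A \<longrightarrow> (\<exists>i j. i < j \<and> P (f i) (f j)))"

lemma almost_full_onD:
  assumes "almost_full_on P A" "\<And>i. f i \<in> A"
  shows "\<exists>i j :: nat. i < j \<and> P (f i) (f j)"
  using assms unfolding almost_full_on_def by (simp add: image_subset_iff)

text \<open>
  Only finitely many indices \<open>i\<close> have no later \<open>j\<close> with \<open>P (f i) (f j)\<close>, since infinitely many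
  would form a sequence without an increasing pair.  Beyond these, one can climb forever.
\<close>

lemma almost_full_on_mono_subseq:
  assumes af: "almost_full_on P A" and tr: "transp P" and f: "\<And>i. f i \<in> A"
  obtains \<phi> :: "nat \<Rightarrow> nat" where "strict_mono \<phi>" "\<And>i j. i < j \<Longrightarrow> P (f (\<phi> i)) (f (\<phi> j))"
proof -
  define T where "T = {i. \<forall>j>i. \<not> P (f i) (f j)}"
  have "finite T"
  proof (rule ccontr)
    assume "infinite T"
    then have e: "strict_mono (enumerate T)" "\<And>n. enumerate T n \<in> T"
      by (auto simp: strict_mono_enumerate enumerate_in_set)
    obtain i j where "i < j" "P (f (enumerate T i)) (f (enumerate T j))"
      using almost_full_onD[OF af, of "\<lambda>n. f (enumerate T n)", OF f] by blast
    moreover from \<open>i < j\<close> e(1) have "enumerate T i < enumerate T j"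
      by (simp add: strict_mono_less)
    ultimately show False using e(2)[of i] by (auto simp: T_def)
  qed
  then obtain N where N: "\<And>i. i \<in> T \<Longrightarrow> i < N"
    unfolding finite_nat_set_iff_bounded by blast
  \<comment> \<open>From \<open>N\<close> on, every index has a successor; transitivity extends this to all pairs.\<close>
  have "\<exists>\<phi>. \<forall>n. N \<le> \<phi> n \<and> (\<phi> n < \<phi> (Suc n) \<and> P (f (\<phi> n)) (f (\<phi> (Suc n))))"
  proof (rule dependent_nat_choice)
    fix x n :: nat assume "N \<le> x"
    then have "x \<notin> T" using N by force
    then obtain y where "y > x" "P (f x) (f y)" by (auto simp: T_def)
    then show "\<exists>y. N \<le> y \<and> x < y \<and> P (f x) (f y)" using \<open>N \<le> x\<close> by (intro exI[of _ y]) auto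
  qed auto
  then obtain \<phi> where \<phi>: "\<And>n. \<phi> n < \<phi> (Suc n)" "\<And>n. P (f (\<phi> n)) (f (\<phi> (Suc n)))" by blast
  show ?thesis
  proof
    show "strict_mono \<phi>" using \<phi>(1) by (simp add: strict_mono_Suc_iff)
    fix i j :: nat assume "i < j"
    then show "P (f (\<phi> i)) (f (\<phi> j))"
    proof (induction rule: less_Suc_induct)
      case (2 i j k)
      then show ?case using tr by (meson transpE)
    qed (fact \<phi>(2))
  qed
qed

lemma almost_full_on_prod:
  assumes "almost_full_on P A" "transp P" "almost_full_on Q B"
  shows "almost_full_on (rel_prod P Q) (A \<times> B)"
  unfolding almost_full_on_def
proof (intro allI impI)
  fix f :: "nat \<Rightarrow> _" assume "range f \<subseteq> A \<times> B"
  then have A: "\<And>i. fst (f i) \<in> A" and B: "\<And>i. snd (f i) \<in> B"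
    by (auto simp: mem_Times_iff image_subset_iff)
  obtain \<phi> :: "nat \<Rightarrow> nat" where \<phi>: "strict_mono \<phi>"
    "\<And>i j. i < j \<Longrightarrow> P (fst (f (\<phi> i))) (fst (f (\<phi> j)))"
    using almost_full_on_mono_subseq[OF assms(1,2), of "\<lambda>i. fst (f i)", OF A] by blast
  obtain i j where "i < j" "Q (snd (f (\<phi> i))) (snd (f (\<phi> j)))"
    using almost_full_onD[OF assms(3), of "\<lambda>i. snd (f (\<phi> i))", OF B] by blast
  moreover have "\<phi> i < \<phi> j" using \<phi>(1) \<open>i < j\<close> by (simp add: strict_mono_less)
  moreover have "P (fst (f (\<phi> i))) (fst (f (\<phi> j)))" using \<phi>(2) \<open>i < j\<close> .
  ultimately show "\<exists>i j. i < j \<and> rel_prod P Q (f i) (f j)"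
    unfolding rel_prod_sel by blast
qed

lemma almost_full_on_hom:
  assumes "almost_full_on Q B" "\<And>x. x \<in> A \<Longrightarrow> h x \<in> B"
    "\<And>x y. x \<in> A \<Longrightarrow> y \<in> A \<Longrightarrow> Q (h x) (h y) \<Longrightarrow> P x y"
  shows "almost_full_on P A"
  unfolding almost_full_on_def
proof (intro allI impI)
  fix f :: "nat \<Rightarrow> _" assume f: "range f \<subseteq> A"
  then have "h (f i) \<in> B" for i using assms(2) by blast
  from almost_full_onD[OF assms(1), of "\<lambda>i. h (f i)", OF this]
  obtain i j where "i < j" "Q (h (f i)) (h (f j))" by blast
  then show "\<exists>i j. i < j \<and> P (f i) (f j)"
    using assms(3) f by blast
qed

lemma almost_full_on_nat: "almost_full_on (\<le>) (UNIV :: nat set)"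
  unfolding almost_full_on_def
proof (intro allI impI)
  fix f :: "nat \<Rightarrow> nat"
  obtain i where "\<And>j. f i \<le> f j"
    using ex_has_least_nat[of "\<lambda>_. True" 0 f] by auto
  then show "\<exists>i j. i < j \<and> f i \<le> f j" by (intro exI[of _ i] exI[of _ "Suc i"]) auto
qed

abbreviation vec_le :: "nat list \<Rightarrow> nat list \<Rightarrow> bool" where
  "vec_le \<equiv> list_all2 (\<le>)"

lemma transp_vec_le: "transp vec_le"
  by (rule list.rel_transp) (simp add: transp_def)

text \<open>
  Dickson's lemma: a vector is its first entry together with the rest, so the lemma on products
  applies.
\<close>

lemma dickson: "almost_full_on vec_le {a. length a = i}"
proof (induction i)
  case 0
  then show ?case by (auto simp: almost_full_on_def image_subset_iff intro: exI[of _ "Suc 0"])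
next
  case (Suc i)
  have "almost_full_on (rel_prod (\<le>) vec_le) ((UNIV :: nat set) \<times> {a. length a = i})"
    by (intro almost_full_on_prod almost_full_on_nat Suc) (simp add: transp_def)
  then show ?case
    by (rule almost_full_on_hom[where h = "\<lambda>a. (hd a, tl a)"])
      (auto simp: length_Suc_conv)
qed

text \<open>
  Higman's lemma, by the minimal bad sequence argument of Nash-Williams: choose a bad sequence
  \<open>g\<close> whose words are successively as short as possible.  Its first letters have an increasing
  subsequence; removing them from that subsequence, and dropping the other words from its start
  on, leaves a bad sequence that contradicts the minimality of \<open>g\<close>.
\<close>

lemma higman:
  assumes af: "almost_full_on P A" and tr: "transp P"
  shows "almost_full_on (list_emb P) (lists A)"
proof (rule ccontr)
  define bad where "bad f \<longleftrightarrow> (\<forall>i. f i \<in> lists A) \<and> (\<forall>i j. i < j \<longrightarrow> \<not> list_emb P (f i) (f j))"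
    for f :: "nat \<Rightarrow> _"
  define least where "least n f \<longleftrightarrow> bad f \<and>
      (\<forall>h. bad h \<longrightarrow> (\<forall>i<n. h i = f i) \<longrightarrow> length (f n) \<le> length (h n))" for n f
  have ex_least: "\<exists>f'. least n f' \<and> (\<forall>i<n. f' i = f i)" if "bad f" for f n
  proof -
    have "\<exists>f'. (bad f' \<and> (\<forall>i<n. f' i = f i)) \<and>
        (\<forall>h. bad h \<and> (\<forall>i<n. h i = f i) \<longrightarrow> length (f' n) \<le> length (h n))"
      by (rule ex_has_least_nat[of _ f]) (use that in blast)
    then obtain f' where f': "bad f'" "\<forall>i<n. f' i = f i"
      "\<And>h. bad h \<Longrightarrow> \<forall>i<n. h i = f i \<Longrightarrow> length (f' n) \<le> length (h n)"
      by (elim exE conjE) (rule that, blast+)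
    have "length (f' n) \<le> length (h n)" if "bad h" "\<forall>i<n. h i = f' i" for h
      using that f'(2) by (intro f'(3)) (rule that, metis)
    with f' show ?thesis unfolding least_def by blast
  qed
  assume "\<not> ?thesis"
  then obtain f0 where "bad f0"
    unfolding almost_full_on_def bad_def image_subset_iff by blast
  have "\<exists>F. \<forall>n. least n (F n) \<and> (\<forall>i<Suc n. F (Suc n) i = F n i)"
  proof (rule dependent_nat_choice)
    show "\<exists>f. least 0 f" using ex_least[OF \<open>bad f0\<close>] by blast
    fix f n assume "least n f"
    then have "bad f" by (simp add: least_def)
    then show "\<exists>f'. least (Suc n) f' \<and> (\<forall>i<Suc n. f' i = f i)" by (rule ex_least)
  qed
  then obtain F where F: "\<And>n. least n (F n)" and FS: "\<And>n i. i \<le> n \<Longrightarrow> F (Suc n) i = F n i"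
    by (auto simp: less_Suc_eq_le)
  \<comment> \<open>\<open>F n\<close> is minimal at position \<open>n\<close>, and later choices leave it unchanged up to there.\<close>
  define g where "g n = F n n" for n
  have Fg: "F n i = g i" if "i \<le> n" for i n
    using that unfolding g_def by (induction n rule: dec_induct) (auto simp: FS)
  have badF: "bad (F n)" for n using F by (simp add: least_def)
  have g: "\<And>i. g i \<in> lists A" using badF unfolding g_def bad_def by blast
  have nemb: "\<not> list_emb P (g i) (g j)" if "i < j" for i j
    using badF[of j] that Fg[of i j] Fg[of j j] unfolding bad_def by (metis less_imp_le order_refl)
  have min: "length (g n) \<le> length (h n)" if "bad h" "\<And>i. i < n \<Longrightarrow> h i = g i" for h n
    using F[of n] that Fg unfolding least_def by (metis g_def less_imp_le)
  have ne: "g i \<noteq> []" for i using nemb[of i "Suc i"] by auto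
  have hdA: "hd (g i) \<in> A" for i using g[of i] ne[of i] by (cases "g i") auto
  obtain \<phi> :: "nat \<Rightarrow> nat" where \<phi>: "strict_mono \<phi>"
    "\<And>i j. i < j \<Longrightarrow> P (hd (g (\<phi> i))) (hd (g (\<phi> j)))"
    using almost_full_on_mono_subseq[OF af tr, of "\<lambda>i. hd (g i)", OF hdA] by blast
  \<comment> \<open>The smaller bad sequence, which keeps \<open>g\<close> up to the start \<open>\<phi> 0\<close> of the subsequence.\<close>
  define h where "h i = (if i < \<phi> 0 then g i else tl (g (\<phi> (i - \<phi> 0))))" for i
  have "bad h"
    unfolding bad_def
  proof (intro conjI allI impI)
    show "h i \<in> lists A" for i
      using g ne unfolding h_def by (auto dest: list.set_sel(2))
    fix i j :: nat assume "i < j"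
    consider "j < \<phi> 0" | "i < \<phi> 0" "\<phi> 0 \<le> j" | "\<phi> 0 \<le> i" by linarith
    then show "\<not> list_emb P (h i) (h j)"
    proof cases
      case 1
      then show ?thesis using \<open>i < j\<close> nemb by (simp add: h_def)
    next
      case 2
      have "\<phi> 0 \<le> \<phi> (j - \<phi> 0)" using \<phi>(1) by (simp add: strict_mono_less_eq)
      then have "\<not> list_emb P (g i) (g (\<phi> (j - \<phi> 0)))" using 2 nemb by simp
      then show ?thesis using 2 ne[of "\<phi> (j - \<phi> 0)"]
        by (metis h_def not_le list.collapse list_emb_Cons)
    next
      case 3
      then have lt: "i - \<phi> 0 < j - \<phi> 0" using \<open>i < j\<close> by simp
      then have "\<not> list_emb P (g (\<phi> (i - \<phi> 0))) (g (\<phi> (j - \<phi> 0)))"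
        using nemb \<phi>(1) by (simp add: strict_mono_less)
      then have "\<not> list_emb P (tl (g (\<phi> (i - \<phi> 0)))) (tl (g (\<phi> (j - \<phi> 0))))"
        using \<phi>(2)[OF lt] ne by (metis list.collapse list_emb_Cons2)
      then show ?thesis using 3 \<open>i < j\<close> by (simp add: h_def)
    qed
  qed
  then have "length (g (\<phi> 0)) \<le> length (h (\<phi> 0))" by (rule min) (simp add: h_def)
  then show False using ne[of "\<phi> 0"] by (cases "g (\<phi> 0)") (simp_all add: h_def)
qed

definition upset :: "('a \<Rightarrow> 'a \<Rightarrow> bool) \<Rightarrow> 'a set \<Rightarrow> 'a set \<Rightarrow> bool" where
  "upset P A U \<longleftrightarrow> U \<subseteq> A \<and> (\<forall>x\<in>U. \<forall>y\<in>A. P x y \<longrightarrow> y \<in> U)"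

lemma upsetI:
  assumes "U \<subseteq> A" "\<And>x y. x \<in> U \<Longrightarrow> y \<in> A \<Longrightarrow> P x y \<Longrightarrow> y \<in> U"
  shows "upset P A U"
  using assms by (auto simp: upset_def)

lemma upsetD: "upset P A U \<Longrightarrow> x \<in> U \<Longrightarrow> y \<in> A \<Longrightarrow> P x y \<Longrightarrow> y \<in> U"
  by (auto simp: upset_def)

text \<open>
  The ascending chain condition: picking a new element at each step of a strictly increasing chain
  of upward closed sets would give a sequence without an increasing pair.
\<close>

lemma wf_upset:
  assumes "almost_full_on P A"
  shows "wf {(V, U). upset P A U \<and> upset P A V \<and> U \<subset> V}"
  unfolding wf_iff_no_infinite_down_chain
proof
  assume "\<exists>F. \<forall>i. (F (Suc i), F i) \<in> {(V, U). upset P A U \<and> upset P A V \<and> U \<subset> V}"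
  then obtain F where F: "\<And>i. upset P A (F i)" "\<And>i. F i \<subset> F (Suc i)" by blast
  have "\<exists>x. \<forall>i. x i \<in> F (Suc i) - F i"
    by (intro choice allI) (use F(2) in blast)
  then obtain x where x: "\<And>i. x i \<in> F (Suc i) - F i" by blast
  then have xA: "x i \<in> A" for i using F(1)[of "Suc i"] by (auto simp: upset_def)
  obtain i j where ij: "i < j" "P (x i) (x j)"
    using almost_full_onD[OF assms, of x, OF xA] by (elim exE conjE) (rule that)
  have "F (Suc i) \<subseteq> F j"
  proof (rule lift_Suc_mono_le)
    show "F n \<subseteq> F (Suc n)" for n using F(2)[of n] by blast
  qed (use ij(1) in simp)
  then have "x i \<in> F j" using x by blast
  then have "x j \<in> F j" using F(1)[of j] ij(2) xA unfolding upset_def by blast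
  then show False using x by blast
qed

section \<open>Rational power series in two variables\<close>

lemma fps_of_poly2_eq_iff: "fps_of_poly2 P = fps_of_poly2 Q \<longleftrightarrow> P = Q"
  by (auto simp: fps_eq_iff poly_eq_iff fps_of_poly2_nth)

lemma fps_of_poly2_0 [simp]: "fps_of_poly2 0 = 0"
  by (simp add: fps_eq_iff fps_of_poly2_nth)

lemma fps_of_poly2_eq_0_iff [simp]: "fps_of_poly2 P = 0 \<longleftrightarrow> P = 0"
  using fps_of_poly2_eq_iff[of P 0] by simp

lemma fps_of_poly2_add: "fps_of_poly2 (P + Q) = fps_of_poly2 P + fps_of_poly2 Q"
  by (simp add: fps_eq_iff fps_of_poly2_nth)

lemma fps_of_poly2_mult: "fps_of_poly2 (P * Q) = fps_of_poly2 P * fps_of_poly2 Q"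
proof (rule fps_ext)
  fix n
  have nth: "fps_nth (fps_of_poly2 R) n = fps_of_poly (coeff R n)" for R n
    by (simp add: fps_of_poly2_def coeff_map_poly)
  show "fps_nth (fps_of_poly2 (P * Q)) n = fps_nth (fps_of_poly2 P * fps_of_poly2 Q) n"
    by (simp add: nth fps_mult_nth coeff_mult fps_of_poly_sum fps_of_poly_mult atLeast0AtMost)
qed

definition fps_s :: "int fps fps" where "fps_s = fps_X"

definition fps_t :: "int fps fps" where "fps_t = fps_const fps_X"

lemma fps_of_poly2_const: "fps_of_poly2 [:[:c:]:] = of_int c"
  by (simp add: fps_eq_iff fps_of_poly2_nth coeff_pCons fps_of_int[symmetric] split: nat.splits)

lemma fps_of_poly2_1: "fps_of_poly2 1 = 1"
  using fps_of_poly2_const[of 1] by (simp add: one_pCons)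

lemma fps_of_poly2_s: "fps_of_poly2 [:0, 1:] = fps_s"
  by (simp add: fps_eq_iff fps_of_poly2_nth fps_s_def coeff_pCons fps_X_def split: nat.splits)

lemma fps_of_poly2_t: "fps_of_poly2 [:[:0, 1:]:] = fps_t"
  by (simp add: fps_eq_iff fps_of_poly2_nth fps_t_def coeff_pCons fps_X_def split: nat.splits)

lemma rational_fps2_of_poly2: "rational_fps2 (fps_of_poly2 P)"
  unfolding rational_fps2_def by (intro exI[of _ P] exI[of _ 1]) (simp add: fps_of_poly2_1)

lemma rational_fps2_of_int: "rational_fps2 (of_int c)"
  using rational_fps2_of_poly2[of "[:[:c:]:]"] by (simp add: fps_of_poly2_const)

lemma rational_fps2_0: "rational_fps2 0" and rational_fps2_1: "rational_fps2 1"
  using rational_fps2_of_int[of 0] rational_fps2_of_int[of 1] by simp_all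

lemma rational_fps2_s: "rational_fps2 fps_s"
  using rational_fps2_of_poly2[of "[:0, 1:]"] by (simp add: fps_of_poly2_s)

lemma rational_fps2_t: "rational_fps2 fps_t"
  using rational_fps2_of_poly2[of "[:[:0, 1:]:]"] by (simp add: fps_of_poly2_t)

lemma rational_fps2_add:
  assumes "rational_fps2 F" "rational_fps2 G"
  shows "rational_fps2 (F + G)"
proof -
  obtain P Q P' Q' where *: "Q \<noteq> 0" "fps_of_poly2 Q * F = fps_of_poly2 P"
    "Q' \<noteq> 0" "fps_of_poly2 Q' * G = fps_of_poly2 P'"
    using assms unfolding rational_fps2_def by blast
  have "fps_of_poly2 (Q * Q') * (F + G) =
      fps_of_poly2 Q' * (fps_of_poly2 Q * F) + fps_of_poly2 Q * (fps_of_poly2 Q' * G)"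
    by (simp add: fps_of_poly2_mult algebra_simps)
  also have "\<dots> = fps_of_poly2 (Q' * P + Q * P')"
    by (simp add: * fps_of_poly2_mult fps_of_poly2_add)
  finally show ?thesis using * unfolding rational_fps2_def by (metis mult_eq_0_iff)
qed

lemma rational_fps2_mult:
  assumes "rational_fps2 F" "rational_fps2 G"
  shows "rational_fps2 (F * G)"
proof -
  obtain P Q P' Q' where *: "Q \<noteq> 0" "fps_of_poly2 Q * F = fps_of_poly2 P"
    "Q' \<noteq> 0" "fps_of_poly2 Q' * G = fps_of_poly2 P'"
    using assms unfolding rational_fps2_def by blast
  have "fps_of_poly2 (Q * Q') * (F * G) = (fps_of_poly2 Q * F) * (fps_of_poly2 Q' * G)"
    by (simp add: fps_of_poly2_mult algebra_simps)
  also have "\<dots> = fps_of_poly2 (P * P')" by (simp add: * fps_of_poly2_mult)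
  finally show ?thesis using * unfolding rational_fps2_def by (metis mult_eq_0_iff)
qed

text \<open>
  Stated with a product because \<open>D\<close> need not be a unit of the ring of power series.
\<close>

lemma rational_fps2_divide:
  assumes "rational_fps2 (D * F)" "rational_fps2 D" "D \<noteq> 0"
  shows "rational_fps2 F"
proof -
  obtain P Q P' Q' where *: "Q \<noteq> 0" "fps_of_poly2 Q * (D * F) = fps_of_poly2 P"
    "Q' \<noteq> 0" "fps_of_poly2 Q' * D = fps_of_poly2 P'"
    using assms unfolding rational_fps2_def by blast
  have "P' \<noteq> 0" using *(3,4) \<open>D \<noteq> 0\<close> by (metis fps_of_poly2_eq_0_iff mult_eq_0_iff)
  have "fps_of_poly2 (Q * P') * F = fps_of_poly2 Q' * (fps_of_poly2 Q * (D * F))"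
    by (simp add: fps_of_poly2_mult *(4)[symmetric] algebra_simps)
  also have "\<dots> = fps_of_poly2 (Q' * P)" by (simp add: * fps_of_poly2_mult)
  finally show ?thesis using *(1) \<open>P' \<noteq> 0\<close> unfolding rational_fps2_def by (metis mult_eq_0_iff)
qed

lemma rational_fps2_diff:
  assumes "rational_fps2 F" "rational_fps2 G"
  shows "rational_fps2 (F - G)"
  using rational_fps2_add[OF assms(1) rational_fps2_mult[OF rational_fps2_of_int[of "-1"] assms(2)]]
  by simp

text \<open>
  The shape of the sum over all first letters in terms of the series \<open>G\<close> that is still unknown.
\<close>

definition affine_in :: "int fps fps \<Rightarrow> int fps fps \<Rightarrow> bool" where
  "affine_in G F \<longleftrightarrow> (\<exists>A B. rational_fps2 A \<and> rational_fps2 B \<and> F = A + B * G)"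

lemma affine_in_self: "affine_in G G"
  unfolding affine_in_def
  by (intro exI[of _ 0] exI[of _ 1]) (simp add: rational_fps2_0 rational_fps2_1)

lemma affine_in_rational: "rational_fps2 F \<Longrightarrow> affine_in G F"
  unfolding affine_in_def by (intro exI[of _ F] exI[of _ 0]) (simp add: rational_fps2_0)

lemma affine_in_add:
  assumes "affine_in G F" "affine_in G F'"
  shows "affine_in G (F + F')"
proof -
  obtain A B A' B' where "rational_fps2 A" "rational_fps2 B" "F = A + B * G"
    "rational_fps2 A'" "rational_fps2 B'" "F' = A' + B' * G"
    using assms unfolding affine_in_def by blast
  then show ?thesis unfolding affine_in_def
    by (intro exI[of _ "A + A'"] exI[of _ "B + B'"]) (simp add: rational_fps2_add algebra_simps)
qed

lemma affine_in_mult: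
  assumes "rational_fps2 C" "affine_in G F"
  shows "affine_in G (C * F)"
proof -
  obtain A B where "rational_fps2 A" "rational_fps2 B" "F = A + B * G"
    using assms unfolding affine_in_def by blast
  then show ?thesis unfolding affine_in_def using assms(1)
    by (intro exI[of _ "C * A"] exI[of _ "C * B"]) (simp add: rational_fps2_mult algebra_simps)
qed

lemma fps_t_geometric: "rational_fps2 (fps_const (Abs_fps (\<lambda>_. 1)))" (is "rational_fps2 ?E")
  and fps_t_geometric_inverse: "fps_const (Abs_fps (\<lambda>_. 1)) * (1 - fps_t) = 1" (is "?thesis2")
proof -
  have "Abs_fps (\<lambda>_. 1 :: int) * (1 - fps_X) = 1"
    by (auto simp: fps_eq_iff right_diff_distrib fps_mult_fps_X_commute[symmetric] )
  moreover have "(1 - fps_t) = fps_const (1 - fps_X)"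
    by (simp add: fps_t_def flip: fps_const_sub)
  ultimately show th2: ?thesis2 by simp
  show "rational_fps2 ?E"
  proof (rule rational_fps2_divide)
    show "rational_fps2 ((1 - fps_t) * ?E)" using th2 by (simp add: mult.commute rational_fps2_1)
    show "rational_fps2 (1 - fps_t)"
      by (intro rational_fps2_diff rational_fps2_1 rational_fps2_t)
    show "1 - fps_t \<noteq> 0" using th2 by auto
  qed
qed

text \<open>
  The case of the reading process in which lowering an entry leads back to the same set.
\<close>

lemma affine_in_t_loop:
  assumes "F = F0 + fps_t * F" "affine_in G F0"
  shows "affine_in G F"
proof -
  let ?E = "fps_const (Abs_fps (\<lambda>_. 1)) :: int fps fps"
  have "F0 = (1 - fps_t) * F" using assms(1) by (simp add: algebra_simps)
  then have "?E * F0 = F" using fps_t_geometric_inverse by (simp flip: mult.assoc)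
  then show ?thesis using affine_in_mult[OF fps_t_geometric assms(2)] by simp
qed

text \<open>
  The factor \<open>fps_s\<close> makes the equation solvable for \<open>G\<close>: whatever the coefficient \<open>B\<close> of \<open>G\<close> in
  \<open>F\<close> is, \<open>1 - s B\<close> is not \<open>0\<close>.
\<close>

lemma rational_fps2_s_loop:
  assumes "G = A + fps_s * F" "rational_fps2 A" "affine_in G F"
  shows "rational_fps2 G"
proof -
  obtain A' B where B: "rational_fps2 A'" "rational_fps2 B" "F = A' + B * G"
    using assms unfolding affine_in_def by blast
  have "(1 - fps_s * B) * G = A + fps_s * A'"
    using assms(1) unfolding B(3) by (simp add: algebra_simps)
  then have 1: "rational_fps2 ((1 - fps_s * B) * G)"
    by (simp add: assms(2) B(1) rational_fps2_add rational_fps2_mult rational_fps2_s)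
  have 2: "rational_fps2 (1 - fps_s * B)"
    by (simp add: B(2) rational_fps2_diff rational_fps2_mult rational_fps2_s rational_fps2_1)
  have "fps_nth (1 - fps_s * B) 0 = 1" by (simp add: fps_s_def)
  then have "1 - fps_s * B \<noteq> 0" by (metis fps_zero_nth zero_neq_one)
  with 1 2 show ?thesis by (rule rational_fps2_divide)
qed

section \<open>Generating functions\<close>

definition gen_fun :: "('a \<Rightarrow> nat) \<Rightarrow> ('a \<Rightarrow> nat) \<Rightarrow> 'a set \<Rightarrow> int fps fps" where
  "gen_fun l d S = Abs_fps (\<lambda>n. Abs_fps (\<lambda>e. int (card {x \<in> S. l x = n \<and> d x = e})))"

lemma gen_fun_nth: "fps_nth (fps_nth (gen_fun l d S) n) e = int (card {x \<in> S. l x = n \<and> d x = e})"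
  by (simp add: gen_fun_def)

text \<open>
  The finiteness of the fibres is essential, as \<open>card\<close> is \<open>0\<close> on infinite sets.
\<close>

lemma gen_fun_Un:
  assumes "\<And>n e. finite {x \<in> S \<union> T. l x = n \<and> d x = e}" "S \<inter> T = {}"
  shows "gen_fun l d (S \<union> T) = gen_fun l d S + gen_fun l d T"
proof -
  have "card {x \<in> S \<union> T. l x = n \<and> d x = e} =
      card {x \<in> S. l x = n \<and> d x = e} + card {x \<in> T. l x = n \<and> d x = e}" for n e
  proof (subst card_Un_disjoint[symmetric])
    show "finite {x \<in> S. l x = n \<and> d x = e}" "finite {x \<in> T. l x = n \<and> d x = e}"
      by (rule finite_subset[OF _ assms(1)[of n e]], blast)+
  qed (use assms(2) in \<open>auto intro: arg_cong[where f = card]\<close>)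
  then show ?thesis by (simp add: fps_eq_iff gen_fun_nth)
qed

lemma gen_fun_inj_image:
  assumes "inj_on h S" "\<And>x. x \<in> S \<Longrightarrow> l (h x) = l' x" "\<And>x. x \<in> S \<Longrightarrow> d (h x) = d' x"
  shows "gen_fun l d (h ` S) = gen_fun l' d' S"
proof -
  have "{x \<in> h ` S. l x = n \<and> d x = e} = h ` {x \<in> S. l' x = n \<and> d' x = e}" for n e
    using assms(2,3) by auto
  moreover have "inj_on h {x \<in> S. l' x = n \<and> d' x = e}" for n e
    by (rule inj_on_subset[OF assms(1)]) blast
  ultimately show ?thesis by (simp add: gen_fun_def card_image)
qed

lemma gen_fun_Suc_left: "gen_fun (\<lambda>x. Suc (l x)) d S = fps_s * gen_fun l d S"
proof -
  have "fps_nth (gen_fun (\<lambda>x. Suc (l x)) d S) n = fps_nth (fps_s * gen_fun l d S) n" for n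
    by (cases n) (simp_all add: fps_eq_iff gen_fun_nth fps_s_def)
  then show ?thesis by (rule fps_ext)
qed

lemma gen_fun_Suc_right: "gen_fun l (\<lambda>x. Suc (d x)) S = fps_t * gen_fun l d S"
proof -
  have "fps_nth (fps_nth (gen_fun l (\<lambda>x. Suc (d x)) S) n) e =
      fps_nth (fps_nth (fps_t * gen_fun l d S) n) e" for n e
    by (cases e) (simp_all add: gen_fun_nth fps_t_def)
  then show ?thesis by (simp add: fps_eq_iff)
qed

section \<open>Upward closed sets of words have rational generating functions\<close>

text \<open>
  A configuration \<open>(a, w)\<close> is what remains to be read of a word over \<open>\<nat>\<^sup>r\<close> in the course of
  reading a letter: \<open>a\<close> is the unread part of the current letter and \<open>w\<close> consists of the later
  letters.  Words themselves are the configurations \<open>([], w)\<close>.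
\<close>

type_synonym config = "nat list \<times> nat list list"

definition configs :: "nat \<Rightarrow> nat \<Rightarrow> config set" where
  "configs r i = {a. length a = i} \<times> lists {b. length b = r}"

abbreviation config_le :: "config \<Rightarrow> config \<Rightarrow> bool" where
  "config_le \<equiv> rel_prod vec_le (list_emb vec_le)"

definition config_len :: "config \<Rightarrow> nat" where
  "config_len x = length (snd x)"

definition config_deg :: "config \<Rightarrow> nat" where
  "config_deg x = sum_list (fst x) + sum_list (map sum_list (snd x))"

abbreviation config_gf :: "config set \<Rightarrow> int fps fps" where
  "config_gf \<equiv> gen_fun config_len config_deg"

abbreviation config_upset :: "nat \<Rightarrow> nat \<Rightarrow> config set \<Rightarrow> bool" where
  "config_upset r i \<equiv> upset config_le (configs r i)"

lemma almost_full_on_configs: "almost_full_on config_le (configs r i)"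
  unfolding configs_def
  by (intro almost_full_on_prod higman dickson transp_vec_le)

lemma finite_configs: "finite {x \<in> configs r i. config_len x = n \<and> config_deg x = e}"
proof (rule finite_subset)
  let ?L = "\<lambda>i. {a. set a \<subseteq> {..e} \<and> length a = i}"
  show "{x \<in> configs r i. config_len x = n \<and> config_deg x = e} \<subseteq>
      ?L i \<times> {w. set w \<subseteq> ?L r \<and> length w = n}"
  proof (clarify, intro conjI SigmaI CollectI subsetI)
    fix a w assume aw: "(a, w) \<in> configs r i" "n = config_len (a, w)" "e = config_deg (a, w)"
    then show "length a = i" "length w = config_len (a, w)"
      by (auto simp: configs_def config_len_def)
    show "k \<in> {..config_deg (a, w)}" if "k \<in> set a" for k
      using member_le_sum_list[OF that] by (simp add: config_deg_def trans_le_add1)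
    fix b assume b: "b \<in> set w"
    then show "length b = r" using aw by (auto simp: configs_def)
    fix k assume k: "k \<in> set b"
    have "k \<le> sum_list b" using member_le_sum_list[OF k] by simp
    also have "\<dots> \<le> sum_list (map sum_list w)" using b by (intro member_le_sum_list) auto
    finally show "k \<in> {..config_deg (a, w)}" by (simp add: config_deg_def)
  qed
  show "finite (?L i \<times> {w. set w \<subseteq> ?L r \<and> length w = n})"
    by (intro finite_cartesian_product finite_lists_length_eq) simp_all
qed

lemma finite_upset: "config_upset r i U \<Longrightarrow> finite {x \<in> U. config_len x = n \<and> config_deg x = e}"
  by (rule finite_subset[OF _ finite_configs[of r i n e]]) (auto simp: upset_def)

text \<open>
  The three quotients that correspond to the steps of reading: leaving an entry that has been
  counted down to \<open>0\<close>, lowering the current entry by 1, and moving on to the next letter.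
\<close>

definition zero_head :: "config set \<Rightarrow> config set" where
  "zero_head U = {(a, w). (0 # a, w) \<in> U}"

definition dec_head :: "config set \<Rightarrow> config set" where
  "dec_head U = {(k # a, w) |k a w. (Suc k # a, w) \<in> U}"

definition open_column :: "config set \<Rightarrow> config set" where
  "open_column U = {(a, w). ([], a # w) \<in> U}"

lemma list_emb_vec_le_refl: "list_emb vec_le w w"
  by (rule list_emb_refl) (simp add: list.rel_refl)

lemma upset_zero_head:
  assumes "config_upset r (Suc i) U"
  shows "config_upset r i (zero_head U)"
proof (rule upsetI)
  fix x y assume xy: "x \<in> zero_head U" "y \<in> configs r i" "config_le x y"
  then have "(0 # fst x, snd x) \<in> U" by (auto simp: zero_head_def)
  moreover have "(0 # fst y, snd y) \<in> configs r (Suc i)" using xy by (auto simp: configs_def)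
  moreover have "config_le (0 # fst x, snd x) (0 # fst y, snd y)"
    using xy by (auto simp: rel_prod_sel)
  ultimately have "(0 # fst y, snd y) \<in> U" by (rule upsetD[OF assms])
  then show "y \<in> zero_head U" by (auto simp: zero_head_def case_prod_unfold)
qed (use assms in \<open>auto simp: zero_head_def configs_def upset_def\<close>)

lemma upset_dec_head:
  assumes "config_upset r (Suc i) U"
  shows "config_upset r (Suc i) (dec_head U)"
proof (rule upsetI)
  fix x y assume xy: "x \<in> dec_head U" "y \<in> configs r (Suc i)" "config_le x y"
  then obtain k a w where x: "x = (k # a, w)" "(Suc k # a, w) \<in> U" by (auto simp: dec_head_def)
  then obtain k' a' w' where y: "y = (k' # a', w')" "k \<le> k'" "vec_le a a'" "list_emb vec_le w w'"
    using xy(3) by (cases y) (auto simp: list_all2_Cons1)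
  note x(2)
  moreover have "(Suc k' # a', w') \<in> configs r (Suc i)"
    using xy(2) unfolding y(1) configs_def by auto
  moreover have "config_le (Suc k # a, w) (Suc k' # a', w')" using y by simp
  ultimately have "(Suc k' # a', w') \<in> U" by (rule upsetD[OF assms])
  then show "y \<in> dec_head U" by (auto simp: dec_head_def y)
qed (use assms in \<open>auto simp: dec_head_def configs_def upset_def\<close>)

lemma upset_open_column:
  assumes "config_upset r 0 U"
  shows "config_upset r r (open_column U)"
proof (rule upsetI)
  fix x y assume xy: "x \<in> open_column U" "y \<in> configs r r" "config_le x y"
  then have "([], fst x # snd x) \<in> U" by (auto simp: open_column_def)
  moreover have "([], fst y # snd y) \<in> configs r 0" using xy by (auto simp: configs_def)
  moreover have "config_le ([], fst x # snd x) ([], fst y # snd y)"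
    using xy by (auto simp: rel_prod_sel)
  ultimately have "([], fst y # snd y) \<in> U" by (rule upsetD[OF assms])
  then show "y \<in> open_column U" by (auto simp: open_column_def case_prod_unfold)
qed (use assms in \<open>auto simp: open_column_def configs_def upset_def\<close>)

text \<open>
  This monotonicity is what makes an induction along the ascending chain condition possible.
\<close>

lemma subset_dec_head: 
  assumes "config_upset r (Suc i) U" shows "U \<subseteq> dec_head U"
proof
  fix x assume x: "x \<in> U"
  with assms have "x \<in> configs r (Suc i)" by (auto simp: upset_def)
  then obtain k a w where [simp]: "x = (k # a, w)" "length a = i" "w \<in> lists {b. length b = r}"
    by (cases x) (auto simp: configs_def length_Suc_conv)
  have "(Suc k # a, w) \<in> configs r (Suc i)" by (simp add: configs_def)
  moreover have "config_le x (Suc k # a, w)"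
    by (simp add: list_emb_vec_le_refl list.rel_refl)
  ultimately have "(Suc k # a, w) \<in> U" using assms x unfolding upset_def by blast
  then show "x \<in> dec_head U" by (auto simp: dec_head_def)
qed

lemma config_gf_head:
  assumes "config_upset r (Suc i) U"
  shows "config_gf U = config_gf (zero_head U) + fps_t * config_gf (dec_head U)"
proof -
  define z :: "config \<Rightarrow> config" where "z = (\<lambda>(a, w). (0 # a, w))"
  define h :: "config \<Rightarrow> config" where "h = (\<lambda>(a, w). (Suc (hd a) # tl a, w))"
  have ne: "fst x \<noteq> []" if "x \<in> dec_head U" for x
    using that by (auto simp: dec_head_def)
  have U: "U = z ` zero_head U \<union> h ` dec_head U"
  proof (intro equalityI subsetI)
    fix x assume x: "x \<in> U"
    with assms obtain k a w where [simp]: "x = (k # a, w)"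
      unfolding upset_def configs_def by (cases x) (auto simp: length_Suc_conv)
    show "x \<in> z ` zero_head U \<union> h ` dec_head U"
    proof (cases k)
      case 0
      then have "x = z (a, w)" "(a, w) \<in> zero_head U" using x by (simp_all add: z_def zero_head_def)
      then show ?thesis by blast
    next
      case (Suc k')
      then have "x = h (k' # a, w)" "(k' # a, w) \<in> dec_head U"
        using x by (simp_all add: h_def dec_head_def)
      then show ?thesis by blast
    qed
  qed (auto simp: z_def h_def zero_head_def dec_head_def)
  have "config_gf U = config_gf (z ` zero_head U) + config_gf (h ` dec_head U)"
  proof (subst U, rule gen_fun_Un)
    show "finite {x \<in> z ` zero_head U \<union> h ` dec_head U. config_len x = n \<and> config_deg x = e}" for n e
      using finite_upset[OF assms] unfolding U[symmetric] .
  qed (auto simp: z_def h_def)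
  also have "config_gf (z ` zero_head U) = config_gf (zero_head U)"
    by (rule gen_fun_inj_image) (auto simp: z_def inj_on_def config_len_def config_deg_def)
  also have "config_gf (h ` dec_head U) = gen_fun config_len (\<lambda>x. Suc (config_deg x)) (dec_head U)"
    by (rule gen_fun_inj_image)
      (auto simp: h_def inj_on_def config_len_def config_deg_def dec_head_def)
  finally show ?thesis by (simp add: gen_fun_Suc_right)
qed

lemma config_gf_open_column:
  assumes "config_upset r 0 W"
  shows "config_gf W = of_bool (([], []) \<in> W) + fps_s * config_gf (open_column W)"
proof -
  define h :: "config \<Rightarrow> config" where "h = (\<lambda>(a, w). ([], a # w))"
  have W: "W = (W \<inter> {([], [])}) \<union> h ` open_column W"
  proof (intro equalityI subsetI)
    fix x assume x: "x \<in> W"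
    with assms obtain w where [simp]: "x = ([], w)"
      unfolding upset_def configs_def by (cases x) auto
    show "x \<in> (W \<inter> {([], [])}) \<union> h ` open_column W"
    proof (cases w)
      case (Cons a v)
      then have "x = h (a, v)" "(a, v) \<in> open_column W"
        using x by (simp_all add: h_def open_column_def)
      then show ?thesis by blast
    qed (use x in simp)
  qed (auto simp: h_def open_column_def)
  have "config_gf W = config_gf (W \<inter> {([], [])}) + config_gf (h ` open_column W)"
  proof (subst W, rule gen_fun_Un)
    show "finite {x \<in> W \<inter> {([], [])} \<union> h ` open_column W. config_len x = n \<and> config_deg x = e}" for n e
      using finite_upset[OF assms] unfolding W[symmetric] .
  qed (auto simp: h_def)
  also have "config_gf (h ` open_column W) =
      gen_fun (\<lambda>x. Suc (config_len x)) config_deg (open_column W)"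
    by (rule gen_fun_inj_image)
      (auto simp: h_def inj_on_def config_len_def config_deg_def open_column_def)
  also have "config_gf (W \<inter> {([], [])}) = of_bool (([], []) \<in> W)"
  proof -
    have "{x \<in> W \<inter> {([], [])}. config_len x = n \<and> config_deg x = e} =
        (if ([], []) \<in> W \<and> n = 0 \<and> e = 0 then {([], [])} else {})" for n e
      by (auto simp: config_len_def config_deg_def)
    then show ?thesis by (auto simp: fps_eq_iff gen_fun_nth)
  qed
  finally show ?thesis by (simp add: gen_fun_Suc_left)
qed

text \<open>
  Reading a partial letter to its end leads to upward closed sets of words that contain \<open>W\<close>.  The
  strictly larger ones are dealt with by \<open>IH\<close> and enter \<open>A\<close> in \<open>A + B H(W)\<close>; the set \<open>W\<close> itself
  is responsible for \<open>B\<close>.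
\<close>

lemma affine_in_config_gf:
  assumes W: "config_upset r 0 W"
    and IH: "\<And>V. config_upset r 0 V \<Longrightarrow> W \<subset> V \<Longrightarrow> rational_fps2 (config_gf V)"
    and U: "config_upset r i U"
    and above: "\<And>a w. length a = i \<Longrightarrow> ([], w) \<in> W \<Longrightarrow> (a, w) \<in> U"
  shows "affine_in (config_gf W) (config_gf U)"
  using U above
proof (induction i arbitrary: U)
  case 0
  have "W \<subseteq> U"
  proof
    fix x assume "x \<in> W"
    moreover from this have "x = ([], snd x)" using W
      unfolding upset_def configs_def by (cases x) auto
    ultimately show "x \<in> U" using 0(2)[of "[]" "snd x"] by simp
  qed
  then consider "U = W" | "W \<subset> U" by blast
  then show ?case
  proof cases
    case 1
    then show ?thesis by (simp add: affine_in_self)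
  next
    case 2
    then show ?thesis by (intro affine_in_rational IH 0)
  qed
next
  case (Suc i)
  from Suc.prems show ?case
  proof (induction U rule: wf_induct_rule[OF wf_upset[OF almost_full_on_configs[of r "Suc i"]]])
    case (1 U)
    note U = \<open>config_upset r (Suc i) U\<close>
    have zero: "affine_in (config_gf W) (config_gf (zero_head U))"
      using 1(3) by (intro Suc.IH upset_zero_head U) (simp add: zero_head_def)
    show ?case
    proof (cases "dec_head U = U")
      case True
      then show ?thesis using config_gf_head[OF U] affine_in_t_loop[OF _ zero] by simp
    next
      case False
      then have "U \<subset> dec_head U" using subset_dec_head[OF U] by blast
      then have "affine_in (config_gf W) (config_gf (dec_head U))"
      proof (intro 1(1))
        fix a :: "nat list" and w assume "length a = Suc i" "([], w) \<in> W"
        then show "(a, w) \<in> dec_head U"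
          using 1(3)[of "Suc (hd a) # tl a" w] by (auto simp: dec_head_def length_Suc_conv)
      qed (use U upset_dec_head[OF U] in auto)
      then show ?thesis using config_gf_head[OF U]
        by (simp add: affine_in_add affine_in_mult zero rational_fps2_t)
    qed
  qed
qed

lemma rational_config_gf:
  assumes "config_upset r 0 W"
  shows "rational_fps2 (config_gf W)"
  using assms
proof (induction W rule: wf_induct_rule[OF wf_upset[OF almost_full_on_configs[of r 0]]])
  case (1 W)
  note W = \<open>config_upset r 0 W\<close>
  have "affine_in (config_gf W) (config_gf (open_column W))"
  proof (rule affine_in_config_gf[OF W _ upset_open_column[OF W]])
    show "rational_fps2 (config_gf V)" if "config_upset r 0 V" "W \<subset> V" for V
      using 1 that by blast
    fix a :: "nat list" and w assume a: "length a = r" and w: "([], w) \<in> W"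
    then have "([], a # w) \<in> configs r 0" using W by (auto simp: upset_def configs_def)
    moreover have "config_le ([], w) ([], a # w)"
      by (simp add: list_emb_Cons list_emb_vec_le_refl)
    ultimately show "(a, w) \<in> open_column W"
      using W w unfolding upset_def open_column_def by blast
  qed
  moreover have "rational_fps2 (of_bool (([], []) \<in> W))"
    by (simp add: rational_fps2_0 rational_fps2_1)
  ultimately show ?case using rational_fps2_s_loop[OF config_gf_open_column[OF W]] by blast
qed

section \<open>Leading monomials and dimension\<close>

text \<open>
  The order on monomials is the lexicographic one for which \<open>x\<^sub>1\<^sub>,\<^sub>0 > x\<^sub>1\<^sub>,\<^sub>1 > \<dots> > x\<^sub>2\<^sub>,\<^sub>0 > \<dots>\<close>, where the
  variables are compared by row first and then by column.  It is compatible with multiplication,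
  and it is preserved by increasing maps of the columns.  It is not a well-order, but only
  finitely many monomials matter in each degree and truncation.
\<close>

definition lead :: "'k::field mpoly \<Rightarrow> monom" where
  "lead p = Max (Poly_Mapping.keys p)"

lemma lead_in_keys: "p \<noteq> 0 \<Longrightarrow> lead p \<in> Poly_Mapping.keys p"
  unfolding lead_def by (intro Max_in) simp_all

lemma le_lead: "m \<in> Poly_Mapping.keys p \<Longrightarrow> m \<le> lead p"
  unfolding lead_def by (intro Max_ge) simp_all

lemma lead_eqI:
  "m \<in> Poly_Mapping.keys p \<Longrightarrow> (\<And>k. k \<in> Poly_Mapping.keys p \<Longrightarrow> k \<le> m) \<Longrightarrow> lead p = m"
  unfolding lead_def by (intro Max_eqI) simp_all

lemma lookup_mpoly_scale:
  "Poly_Mapping.lookup (mpoly_scale c p) m = c * Poly_Mapping.lookup p m"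
  by (simp add: mpoly_scale_def Const_def Poly_Mapping.map.rep_eq when_def
      flip: mult_map_scale_conv_mult)

lemma keys_mpoly_scale: "Poly_Mapping.keys (mpoly_scale c p) \<subseteq> Poly_Mapping.keys p"
  by (auto simp: in_keys_iff lookup_mpoly_scale)

text \<open>
  Elements of \<open>S\<close> with pairwise distinct leading monomials are linearly independent, and if they
  realise all leading monomials, subtracting multiples of them lowers the leading monomial of any
  element of \<open>S\<close> until nothing is left.
\<close>

lemma mpoly_dim_eq_card_lead:
  fixes S :: "'k::field mpoly set"
  assumes zero: "0 \<in> S" and add: "\<And>p q. p \<in> S \<Longrightarrow> q \<in> S \<Longrightarrow> p + q \<in> S"
    and scale: "\<And>c p. p \<in> S \<Longrightarrow> mpoly_scale c p \<in> S"
    and fin: "finite (lead ` (S - {0}))"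
  shows "mpoly_dim S = card (lead ` (S - {0}))"
proof -
  interpret vector_space "mpoly_scale :: 'k \<Rightarrow> _" by (rule vector_space_mpoly)
  define M where "M = lead ` (S - {0})"
  define g where "g = inv_into (S - {0}) lead"
  have g: "g m \<in> S" "g m \<noteq> 0" "lead (g m) = m" if "m \<in> M" for m
    using inv_into_into[of m lead "S - {0}"] f_inv_into_f[of m lead "S - {0}"] that
    unfolding M_def g_def by auto
  have lc: "Poly_Mapping.lookup (g m) m \<noteq> 0" if "m \<in> M" for m
    using lead_in_keys[OF g(2)[OF that]] g(3)[OF that] by (simp add: in_keys_iff)
  have above: "Poly_Mapping.lookup (g m) k = 0" if "m \<in> M" "m < k" for m k
    using le_lead[of k "g m"] g(3)[OF that(1)] that(2) by (metis in_keys_iff not_le)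
  have finM: "finite M" using fin by (simp add: M_def)
  have inj: "inj_on g M" using g(3) by (rule inj_on_inverseI)
  have indep: "independent (g ` M)"
  proof
    assume "dependent (g ` M)"
    then obtain u k where u: "k \<in> M" "u (g k) \<noteq> 0" "(\<Sum>v\<in>g ` M. mpoly_scale (u v) v) = 0"
      using finM by (auto simp: dependent_finite)
    define N where "N = {m \<in> M. u (g m) \<noteq> 0}"
    have N: "finite N" "N \<noteq> {}" using u finM by (auto simp: N_def)
    define m where "m = Max N"
    have m: "m \<in> M" "u (g m) \<noteq> 0" using Max_in[OF N] by (simp_all add: N_def m_def)
    have small: "u (g k) * Poly_Mapping.lookup (g k) m = 0" if "k \<in> M - {m}" for k
    proof (cases "u (g k) = 0")
      case False
      then have "k \<in> N" using that by (simp add: N_def)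
      then have "k \<le> m" using N by (simp add: m_def)
      then have "k < m" using that by (intro le_neq_trans) auto
      then show ?thesis using that above[of k m] by simp
    qed simp
    have "0 = Poly_Mapping.lookup (\<Sum>v\<in>g ` M. mpoly_scale (u v) v) m" using u(3) by simp
    also have "\<dots> = (\<Sum>k\<in>M. u (g k) * Poly_Mapping.lookup (g k) m)"
      by (simp add: lookup_sum lookup_mpoly_scale sum.reindex[OF inj])
    also have "\<dots> = u (g m) * Poly_Mapping.lookup (g m) m"
      unfolding sum.remove[OF finM m(1)] using small by (simp del: mult_eq_0_iff)
    finally show False using m lc by simp
  qed
  have span: "S \<subseteq> span (g ` M)"
  proof (rule ccontr)
    assume "\<not> S \<subseteq> span (g ` M)"
    define N where "N = lead ` (S - span (g ` M))"
    have N: "N \<noteq> {}" "N \<subseteq> M"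
      using \<open>\<not> S \<subseteq> span (g ` M)\<close> span_zero unfolding N_def M_def by blast+
    have finN: "finite N" using finite_subset[OF N(2) finM] .
    define m where "m = Min N"
    have "m \<in> N" using Min_in[OF finN N(1)] by (simp add: m_def)
    then obtain p where p: "p \<in> S" "p \<notin> span (g ` M)" "lead p = m" by (auto simp: N_def)
    have "m \<in> M" using \<open>m \<in> N\<close> N by blast
    \<comment> \<open>The multiple of \<open>g m\<close> that cancels the leading term of \<open>p\<close>.\<close>
  define c where "c = Poly_Mapping.lookup p m / Poly_Mapping.lookup (g m) m"
    define q where "q = p + mpoly_scale (- c) (g m)"
    have qS: "q \<in> S" unfolding q_def using p g \<open>m \<in> M\<close> by (intro add scale)
    have "q \<notin> span (g ` M)"
    proof
      assume "q \<in> span (g ` M)"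
      moreover have "mpoly_scale c (g m) \<in> span (g ` M)"
        using \<open>m \<in> M\<close> by (intro span_scale span_base) blast
      ultimately have "q + mpoly_scale c (g m) \<in> span (g ` M)" by (rule span_add)
      then show False using p by (simp add: q_def scale_minus_left)
    qed
    then have "lead q \<in> N" "q \<noteq> 0" using qS span_zero by (auto simp: N_def)
    then have "m \<le> lead q" using finN by (simp add: m_def)
    moreover have "Poly_Mapping.lookup q m = 0"
      using lc[OF \<open>m \<in> M\<close>] by (simp add: q_def lookup_add lookup_mpoly_scale c_def del: scale_minus_left)
    moreover have "lead q \<in> Poly_Mapping.keys q" using \<open>q \<noteq> 0\<close> by (rule lead_in_keys)
    ultimately have "m < lead q" by (metis in_keys_iff order_le_less)
    have "lead q \<in> Poly_Mapping.keys p \<union> Poly_Mapping.keys (g m)"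
      using \<open>lead q \<in> Poly_Mapping.keys q\<close> keys_mpoly_scale[of "- c" "g m"]
        Poly_Mapping.keys_add[of p "mpoly_scale (- c) (g m)"] unfolding q_def by blast
    then have "lead q \<le> m" using le_lead[of "lead q" p] le_lead[of "lead q" "g m"] p(3) g(3)[OF \<open>m \<in> M\<close>] by auto
    then show False using \<open>m < lead q\<close> by simp
  qed
  have "g ` M \<subseteq> S" using g by blast
  then have "dim S = card (g ` M)" using span indep by (intro dim_unique) auto
  then show ?thesis using card_image[OF inj] by (simp add: mpoly_dim_def M_def)
qed

section \<open>Permutations and leading monomials\<close>

lemma lookup_perm_monom:
  assumes "inj \<sigma>"
  shows "Poly_Mapping.lookup (perm_monom \<sigma> m) (i, \<sigma> j) = Poly_Mapping.lookup m (i, j)"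
proof -
  have "Poly_Mapping.lookup (perm_monom \<sigma> m) (i, \<sigma> j) =
      (\<Sum>v\<in>Poly_Mapping.keys m. if v = (i, j) then Poly_Mapping.lookup m v else 0)"
    unfolding perm_monom_def lookup_sum
    by (intro sum.cong) (auto simp: lookup_single when_def dest: injD[OF assms])
  also have "\<dots> = Poly_Mapping.lookup m (i, j)" by (simp add: in_keys_iff)
  finally show ?thesis .
qed

lemma keys_perm_monom:
  "Poly_Mapping.keys (perm_monom \<sigma> m) \<subseteq> (\<lambda>v. (fst v, \<sigma> (snd v))) ` Poly_Mapping.keys m"
  unfolding perm_monom_def
  by (rule order.trans[OF Poly_Mapping.keys_sum]) (auto split: if_splits)

text \<open>
  On columns in \<open>J\<close>, the permutation preserves the lexicographic order of the variables, so the
  first variable in which \<open>m\<close> and \<open>m'\<close> differ is carried to the first one in which their images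
  differ; the other columns do not occur in either monomial.
\<close>

lemma perm_monom_strict_mono:
  assumes "bij \<sigma>" "strict_mono_on J \<sigma>" "m < m'"
    "Poly_Mapping.keys m \<subseteq> UNIV \<times> J" "Poly_Mapping.keys m' \<subseteq> UNIV \<times> J"
  shows "perm_monom \<sigma> m < perm_monom \<sigma> m'"
proof -
  have inj: "inj \<sigma>" using assms(1) by (simp add: bij_def)
  obtain v where v: "Poly_Mapping.lookup m v < Poly_Mapping.lookup m' v"
    "\<And>u. u < v \<Longrightarrow> Poly_Mapping.lookup m u = Poly_Mapping.lookup m' u"
    using assms(3) unfolding less_poly_mapping.rep_eq less_fun_def by blast
  obtain i j where "v = (i, j)" by (cases v)
  note ij = v[unfolded this]
  have "(i, j) \<in> Poly_Mapping.keys m'" using ij(1) by (auto simp: in_keys_iff)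
  then have "j \<in> J" using assms(5) by auto
  have eq: "Poly_Mapping.lookup (perm_monom \<sigma> m) v = Poly_Mapping.lookup (perm_monom \<sigma> m') v"
    if "v < (i, \<sigma> j)" for v
  proof -
    obtain i' j' where v: "v = (i', \<sigma> j')" using assms(1) by (metis bij_pointE surj_pair)
    show ?thesis
    proof (cases "j' \<in> J")
      case True
      then have "(i', j') < (i, j)"
        using that \<open>j \<in> J\<close> assms(2) by (auto simp: v strict_mono_on_less)
      then show ?thesis using ij(2) by (simp add: v lookup_perm_monom[OF inj])
    next
      case False
      then have "(i', j') \<notin> Poly_Mapping.keys m" "(i', j') \<notin> Poly_Mapping.keys m'"
        using assms(4,5) by auto
      then show ?thesis by (simp add: v lookup_perm_monom[OF inj] in_keys_iff)
    qed
  qed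
  show ?thesis
    unfolding less_poly_mapping.rep_eq less_fun_def
    using ij(1) eq by (intro exI[of _ "(i, \<sigma> j)"]) (simp add: lookup_perm_monom[OF inj])
qed

lemma keys_perm_poly: "Poly_Mapping.keys (perm_poly \<sigma> p) \<subseteq> perm_monom \<sigma> ` Poly_Mapping.keys p"
  unfolding perm_poly_def
  by (rule order.trans[OF Poly_Mapping.keys_sum]) (auto split: if_splits)

lemma perm_poly_lead:
  fixes p :: "'k::field mpoly"
  assumes "bij \<sigma>" "strict_mono_on J \<sigma>" "p \<in> polys (UNIV \<times> J)" "p \<noteq> 0"
  shows "perm_poly \<sigma> p \<noteq> 0" "lead (perm_poly \<sigma> p) = perm_monom \<sigma> (lead p)"
proof -
  have less: "perm_monom \<sigma> m < perm_monom \<sigma> m'"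
    if "m \<in> Poly_Mapping.keys p" "m' \<in> Poly_Mapping.keys p" "m < m'" for m m'
    using assms(3) that by (intro perm_monom_strict_mono[OF assms(1,2)]) (auto simp: polys_def)
  have l: "lead p \<in> Poly_Mapping.keys p" using assms(4) by (rule lead_in_keys)
  have "Poly_Mapping.lookup (perm_poly \<sigma> p) (perm_monom \<sigma> (lead p)) =
      (\<Sum>m\<in>Poly_Mapping.keys p. if m = lead p then Poly_Mapping.lookup p m else 0)"
    unfolding perm_poly_def lookup_sum
  proof (intro sum.cong refl)
    fix m assume m: "m \<in> Poly_Mapping.keys p"
    have "perm_monom \<sigma> m \<noteq> perm_monom \<sigma> (lead p)" if "m \<noteq> lead p"
      using less[OF m l le_neq_trans[OF le_lead[OF m] that]] by simp
    then show "Poly_Mapping.lookup (Poly_Mapping.single (perm_monom \<sigma> m) (Poly_Mapping.lookup p m))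
        (perm_monom \<sigma> (lead p)) = (if m = lead p then Poly_Mapping.lookup p m else 0)"
      by (auto simp: lookup_single when_def)
  qed
  also have "\<dots> = Poly_Mapping.lookup p (lead p)" using l by simp
  finally have l': "perm_monom \<sigma> (lead p) \<in> Poly_Mapping.keys (perm_poly \<sigma> p)"
    using l by (simp add: in_keys_iff)
  then show "perm_poly \<sigma> p \<noteq> 0" by auto
  show "lead (perm_poly \<sigma> p) = perm_monom \<sigma> (lead p)"
  proof (rule lead_eqI[OF l'])
    fix k assume "k \<in> Poly_Mapping.keys (perm_poly \<sigma> p)"
    then obtain m where m: "m \<in> Poly_Mapping.keys p" "k = perm_monom \<sigma> m"
      using keys_perm_poly by blast
    then show "k \<le> perm_monom \<sigma> (lead p)"
      using less[OF m(1) l le_neq_trans[OF le_lead[OF m(1)]]] by (cases "m = lead p") auto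
  qed
qed

lemma monom_mult_lead:
  fixes p :: "'k::field mpoly"
  assumes "p \<noteq> 0"
  shows "Poly_Mapping.single t 1 * p \<noteq> 0" "lead (Poly_Mapping.single t 1 * p) = t + lead p"
proof -
  have eq: "Poly_Mapping.single t 1 * p =
      (\<Sum>m\<in>Poly_Mapping.keys p. Poly_Mapping.single (t + m) (Poly_Mapping.lookup p m))"
    by (subst mpoly_eq_sum_single[of p, symmetric], subst sum_distrib_left) (simp add: mult_single)
  have l: "lead p \<in> Poly_Mapping.keys p" using assms by (rule lead_in_keys)
  have "Poly_Mapping.lookup (Poly_Mapping.single t 1 * p) (t + lead p) =
      (\<Sum>m\<in>Poly_Mapping.keys p. if m = lead p then Poly_Mapping.lookup p m else 0)"
    unfolding eq lookup_sum by (intro sum.cong) (auto simp: lookup_single when_def)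
  also have "\<dots> = Poly_Mapping.lookup p (lead p)" using l by simp
  finally have l': "t + lead p \<in> Poly_Mapping.keys (Poly_Mapping.single t 1 * p)"
    using l by (simp add: in_keys_iff)
  then show "Poly_Mapping.single t 1 * p \<noteq> 0" by auto
  show "lead (Poly_Mapping.single t 1 * p) = t + lead p"
  proof (rule lead_eqI[OF l'])
    fix k assume "k \<in> Poly_Mapping.keys (Poly_Mapping.single t 1 * p)"
    then obtain m where "m \<in> Poly_Mapping.keys p" "k = t + m"
      using keys_mult[of "Poly_Mapping.single t 1" p] by (auto split: if_splits)
    then show "k \<le> t + lead p" by (simp add: le_lead)
  qed
qed

section \<open>Monomials as words\<close>

lemma list_emb_index:
  assumes "list_emb P w v"
  shows "\<exists>\<tau>. strict_mono_on {..<length w} \<tau> \<and> (\<forall>j<length w. \<tau> j < length v \<and> P (w ! j) (v ! \<tau> j))"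
  using assms
proof (induction rule: list_emb.induct)
  case (list_emb_Nil ys)
  then show ?case by (simp add: strict_mono_on_def)
next
  case (list_emb_Cons xs ys y)
  then obtain \<tau> where "strict_mono_on {..<length xs} \<tau>"
    "\<forall>j<length xs. \<tau> j < length ys \<and> P (xs ! j) (ys ! \<tau> j)" by blast
  then show ?case
    by (intro exI[of _ "\<lambda>j. Suc (\<tau> j)"]) (auto simp: strict_mono_on_def)
next
  case (list_emb_Cons2 x y xs ys)
  then obtain \<tau> where "strict_mono_on {..<length xs} \<tau>"
    "\<forall>j<length xs. \<tau> j < length ys \<and> P (xs ! j) (ys ! \<tau> j)" by blast
  then show ?case using list_emb_Cons2(1)
    by (intro exI[of _ "case_nat 0 (\<lambda>j. Suc (\<tau> j))"])
      (auto simp: strict_mono_on_def less_Suc_eq_0_disj split: nat.splits)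
qed

text \<open>
  The complements of \<open>A\<close> and of its image are both infinite sets of natural numbers.
\<close>

lemma extend_to_bij:
  fixes \<tau> :: "nat \<Rightarrow> nat"
  assumes "inj_on \<tau> A" "finite A"
  obtains \<sigma> where "bij \<sigma>" "\<And>j. j \<in> A \<Longrightarrow> \<sigma> j = \<tau> j"
proof -
  have inf: "infinite (- A)" "infinite (- \<tau> ` A)"
    using assms(2) by (simp_all add: Compl_eq_Diff_UNIV)
  have "bij_betw (enumerate (- \<tau> ` A) \<circ> inv_into UNIV (enumerate (- A))) (- A) (- \<tau> ` A)"
    by (rule bij_betw_trans[OF bij_betw_inv_into bij_enumerate]) (intro bij_enumerate inf)+
  then obtain \<rho> where \<rho>: "bij_betw \<rho> (- A) (- \<tau> ` A)" by blast
  define \<sigma> where "\<sigma> j = (if j \<in> A then \<tau> j else \<rho> j)" for j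
  have "bij_betw \<sigma> A (\<tau> ` A)"
    using assms(1) by (simp add: bij_betw_def \<sigma>_def inj_on_def)
  moreover have "bij_betw \<sigma> (- A) (- \<tau> ` A)"
    using \<rho> by (rule bij_betw_cong[THEN iffD1, rotated]) (simp add: \<sigma>_def)
  ultimately have "bij_betw \<sigma> (A \<union> - A) (\<tau> ` A \<union> - \<tau> ` A)"
    by (rule bij_betw_combine) blast
  then have "bij \<sigma>" by simp
  then show thesis by (rule that) (simp add: \<sigma>_def)
qed

text \<open>
  Letter \<open>j\<close> of the word lists the exponents of \<open>x\<^sub>1\<^sub>,\<^sub>j, \<dots>, x\<^sub>r\<^sub>,\<^sub>j\<close>; the rows are counted from 1, list
  positions from 0.
\<close>

definition word_exp :: "nat \<Rightarrow> nat list list \<Rightarrow> var \<Rightarrow> nat" where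
  "word_exp r w = (\<lambda>(i, j). if i \<in> {1..r} \<and> j < length w then w ! j ! (i - 1) else 0)"

definition word_monom :: "nat \<Rightarrow> nat list list \<Rightarrow> monom" where
  "word_monom r w = Abs_poly_mapping (word_exp r w)"

lemma lookup_word_monom: "Poly_Mapping.lookup (word_monom r w) = word_exp r w"
  unfolding word_monom_def
proof (rule lookup_Abs_poly_mapping)
  have "finite ({1..r} \<times> {..<length w})" by simp
  then show "finite {v. word_exp r w v \<noteq> 0}"
    by (rule rev_finite_subset) (auto simp: word_exp_def split: if_splits)
qed

lemma keys_word_monom: "Poly_Mapping.keys (word_monom r w) \<subseteq> {1..r} \<times> {..<length w}"
  by (auto simp: in_keys_iff lookup_word_monom word_exp_def split: if_splits)

lemma inj_word_monom:
  "inj_on (word_monom r) {w \<in> lists {b. length b = r}. length w = n}"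
proof (rule inj_onI)
  fix w v assume w: "w \<in> {w \<in> lists {b. length b = r}. length w = n}"
    and v: "v \<in> {w \<in> lists {b. length b = r}. length w = n}"
    and eq: "word_monom r w = word_monom r v"
  show "w = v"
  proof (rule nth_equalityI)
    show "length w = length v" using w v by simp
    fix j assume j: "j < length w"
    then have jv: "j < length v" using w v by simp
    have len: "length (w ! j) = r" "length (v ! j) = r"
      using w v nth_mem[OF j] nth_mem[OF jv] by (auto simp: in_lists_conv_set)
    show "w ! j = v ! j"
    proof (rule nth_equalityI)
      show "length (w ! j) = length (v ! j)" using len by simp
      fix i assume i: "i < length (w ! j)"
      have "word_exp r w (Suc i, j) = word_exp r v (Suc i, j)"
        using eq by (simp flip: lookup_word_monom)
      then show "w ! j ! i = v ! j ! i" using i j jv len by (simp add: word_exp_def)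
    qed
  qed
qed

lemma word_monom_surj:
  assumes "Poly_Mapping.keys m \<subseteq> {1..r} \<times> {..<n}"
  obtains w where "w \<in> lists {b. length b = r}" "length w = n" "word_monom r w = m"
proof
  let ?w = "map (\<lambda>j. map (\<lambda>i. Poly_Mapping.lookup m (Suc i, j)) [0..<r]) [0..<n]"
  show "?w \<in> lists {b. length b = r}" "length ?w = n" by auto
  show "word_monom r ?w = m"
  proof (rule poly_mapping_eqI)
    fix v
    have "Poly_Mapping.lookup m v = 0" if "v \<notin> {1..r} \<times> {..<n}"
      using assms that by (auto simp: in_keys_iff)
    then show "Poly_Mapping.lookup (word_monom r ?w) v = Poly_Mapping.lookup m v"
      by (cases v) (auto simp: lookup_word_monom word_exp_def)
  qed
qed

lemma degree_word_monom:
  assumes "w \<in> lists {b. length b = r}"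
  shows "monom_degree (word_monom r w) = sum_list (map sum_list w)"
proof -
  have "monom_degree (word_monom r w) = (\<Sum>v\<in>{1..r} \<times> {..<length w}. word_exp r w v)"
    unfolding monom_degree_def lookup_word_monom[symmetric]
    by (rule sum.mono_neutral_left) (use keys_word_monom in \<open>auto simp: in_keys_iff\<close>)
  also have "\<dots> = (\<Sum>j<length w. \<Sum>i\<in>{1..r}. w ! j ! (i - 1))"
    by (subst sum.swap, subst sum.cartesian_product) (auto simp: word_exp_def intro!: sum.cong)
  also have "\<dots> = (\<Sum>j<length w. sum_list (w ! j))"
  proof (intro sum.cong refl)
    fix j assume "j \<in> {..<length w}"
    then have "length (w ! j) = r" using assms by (auto simp: in_lists_conv_set)
    then show "(\<Sum>i\<in>{1..r}. w ! j ! (i - 1)) = sum_list (w ! j)"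
      by (simp add: sum_list_sum_nth sum.atLeast1_atMost_eq atLeast0LessThan)
  qed
  also have "\<dots> = sum_list (map sum_list w)"
    by (simp add: sum_list_sum_nth atLeast0LessThan)
  finally show ?thesis .
qed

section \<open>The words of leading monomials\<close>

definition leads :: "nat \<Rightarrow> nat \<Rightarrow> 'k::field mpoly set \<Rightarrow> monom set" where
  "leads r n I = lead ` (I \<inter> truncation r n - {0})"

lemma keys_leads:
  assumes "m \<in> leads r n I"
  shows "Poly_Mapping.keys m \<subseteq> {1..r} \<times> {0..n}"
proof -
  obtain p where p: "p \<in> I \<inter> truncation r n - {0}" "m = lead p"
    using assms unfolding leads_def by blast
  then have "m \<in> Poly_Mapping.keys p" using lead_in_keys[of p] by simp
  then show ?thesis using p(1) unfolding truncation_def polys_def by blast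
qed

text \<open>
  Let \<open>f\<close> have the leading monomial of \<open>w\<close>.  The embedding of \<open>w\<close> into \<open>v\<close> is an increasing map of
  columns, which extends to a permutation \<open>\<sigma>\<close>; the exponents of \<open>v\<close> that are still missing after
  applying \<open>\<sigma>\<close> form a monomial \<open>t\<close>, and \<open>t \<cdot> \<sigma> f\<close> has the leading monomial of \<open>v\<close>.
\<close>

lemma leads_word_upward:
  fixes I :: "'k::field mpoly set"
  assumes I: "ideal I (mpoly_ring r)" and sym: "symmetric_stable I"
    and w: "word_monom r w \<in> leads r n I" "length w = Suc n"
    and v: "list_emb vec_le w v" "length v = Suc n'"
      "w \<in> lists {b. length b = r}"
  shows "word_monom r v \<in> leads r n' I"
proof -
  obtain f where f: "f \<in> I" "f \<in> truncation r n" "f \<noteq> 0" "lead f = word_monom r w"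
    using w(1) unfolding leads_def by (elim imageE DiffE IntE) (rule that, simp_all)
  obtain \<tau> where \<tau>: "strict_mono_on {..<length w} \<tau>"
    "\<And>j. j < length w \<Longrightarrow> \<tau> j < length v \<and> vec_le (w ! j) (v ! \<tau> j)"
    using list_emb_index[OF v(1)] by blast
  obtain \<sigma> where \<sigma>: "bij \<sigma>" "\<And>j. j \<in> {..<length w} \<Longrightarrow> \<sigma> j = \<tau> j"
    using extend_to_bij[OF strict_mono_on_imp_inj_on[OF \<tau>(1)]] by blast
  have mono: "strict_mono_on {0..n} \<sigma>"
    using \<tau>(1) \<sigma>(2) w(2) by (simp add: strict_mono_on_def less_Suc_eq_le)
  define t where "t = word_monom r v - perm_monom \<sigma> (word_monom r w)"
  have t: "word_monom r v = t + perm_monom \<sigma> (word_monom r w)"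
  proof (rule poly_mapping_eqI)
    fix u
    obtain i j :: nat where u: "u = (i, \<sigma> j)" using \<sigma>(1) by (metis bij_pointE surj_pair)
    have "word_exp r w (i, j) \<le> word_exp r v (i, \<sigma> j)"
    proof (cases "i \<in> {1..r} \<and> j < length w")
      case True
      then have "length (w ! j) = r" using v(3) by (auto simp: in_lists_conv_set)
      then show ?thesis
        using True \<tau>(2)[of j] \<sigma>(2)[of j] by (auto simp: word_exp_def list_all2_conv_all_nth)
    qed (auto simp: word_exp_def)
    moreover have "Poly_Mapping.lookup (perm_monom \<sigma> (word_monom r w)) u = word_exp r w (i, j)"
      using \<sigma>(1) by (simp add: u lookup_perm_monom bij_is_inj lookup_word_monom)
    ultimately show "Poly_Mapping.lookup (word_monom r v) u =
        Poly_Mapping.lookup (t + perm_monom \<sigma> (word_monom r w)) u"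
      by (simp add: t_def lookup_add lookup_minus lookup_word_monom u)
  qed
  have "Poly_Mapping.keys t \<subseteq> Poly_Mapping.keys (word_monom r v)"
    by (auto simp: in_keys_iff t_def lookup_minus)
  also have "\<dots> \<subseteq> {1..r} \<times> {0..n'}"
    using keys_word_monom[of r v] v(2) by (auto simp: lessThan_Suc_atMost)
  finally have tk: "Poly_Mapping.keys t \<subseteq> {1..r} \<times> {0..n'}" .
  define g where "g = Poly_Mapping.single t 1 * perm_poly \<sigma> f"
  have fJ: "f \<in> polys (UNIV \<times> {0..n})" using f(2) by (auto simp: truncation_def polys_def)
  have p: "perm_poly \<sigma> f \<noteq> 0" "lead (perm_poly \<sigma> f) = perm_monom \<sigma> (word_monom r w)"
    using perm_poly_lead[OF \<sigma>(1) mono fJ f(3)] f(4) by simp_all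
  have "g \<noteq> 0" "lead g = word_monom r v"
    using monom_mult_lead[OF p(1), of t] p(2) t by (simp_all add: g_def)
  moreover have "g \<in> truncation r n'"
    unfolding g_def truncation_def
  proof (rule mult_in_polys)
    show "Poly_Mapping.single t 1 \<in> polys ({1..r} \<times> {0..n'})"
      using tk by (simp add: polys_def)
    show "perm_poly \<sigma> f \<in> polys ({1..r} \<times> {0..n'})"
      unfolding polys_def
    proof (intro CollectI ballI subsetI)
      fix m u assume "m \<in> Poly_Mapping.keys (perm_poly \<sigma> f)" and u: "u \<in> Poly_Mapping.keys m"
      then obtain m' where m': "m' \<in> Poly_Mapping.keys f" "m = perm_monom \<sigma> m'"
        using keys_perm_poly by blast
      then obtain i j where ij: "(i, j) \<in> Poly_Mapping.keys m'" "u = (i, \<sigma> j)"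
        using keys_perm_monom[of \<sigma> m'] u by auto
      then have "(i, j) \<in> {1..r} \<times> {0..n}"
        using f(2) m'(1) unfolding truncation_def polys_def by blast
      then show "u \<in> {1..r} \<times> {0..n'}"
        using \<tau>(2)[of j] \<sigma>(2)[of j] w(2) v(2) by (auto simp: ij(2) less_Suc_eq_le)
    qed
  qed
  moreover have "g \<in> I"
  proof -
    have "perm_poly \<sigma> f \<in> I" using sym \<sigma>(1) f(1) by (auto simp: symmetric_stable_def)
    moreover have "Poly_Mapping.single t 1 \<in> carrier (mpoly_ring r)"
      using tk by (auto simp: mpoly_ring_def polys_def)
    ultimately show ?thesis using ideal.I_l_closed[OF I] by (simp add: g_def mpoly_ring_def)
  qed
  ultimately show ?thesis unfolding leads_def by (intro image_eqI[of _ _ g]) auto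
qed

section \<open>The Hilbert series as a generating function\<close>

lemma lookup_homogeneous_component:
  "Poly_Mapping.lookup (homogeneous_component d p) m =
    (if monom_degree m = d then Poly_Mapping.lookup p m else 0)"
proof -
  have "Poly_Mapping.lookup (homogeneous_component d p) m =
      (\<Sum>k\<in>{k \<in> Poly_Mapping.keys p. monom_degree k = d}.
        if k = m then Poly_Mapping.lookup p k else 0)"
    unfolding homogeneous_component_def lookup_sum
    by (intro sum.cong) (auto simp: lookup_single when_def)
  then show ?thesis by (simp add: in_keys_iff)
qed

text \<open>
  This is where the homogeneity of \<open>I\<close> enters: an element of \<open>I\<close> may be replaced by its
  homogeneous component that contains the leading monomial.
\<close>

lemma leads_degree_part:
  fixes I :: "'k::field mpoly set"
  assumes "homogeneous_ideal r I"
  shows "lead ` (degree_part d (I \<inter> truncation r n) - {0}) = {m \<in> leads r n I. monom_degree m = d}"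
proof (intro equalityI subsetI)
  fix m assume "m \<in> lead ` (degree_part d (I \<inter> truncation r n) - {0})"
  then obtain p where p: "p \<in> degree_part d (I \<inter> truncation r n)" "p \<noteq> 0" "m = lead p" by blast
  then show "m \<in> {m \<in> leads r n I. monom_degree m = d}"
    using lead_in_keys[of p] by (auto simp: degree_part_def leads_def)
next
  fix m assume "m \<in> {m \<in> leads r n I. monom_degree m = d}"
  then obtain p where p: "p \<in> I" "p \<in> truncation r n" "p \<noteq> 0" "m = lead p" "monom_degree m = d"
    by (auto simp: leads_def)
  define q where "q = homogeneous_component d p"
  have keys: "Poly_Mapping.keys q = {k \<in> Poly_Mapping.keys p. monom_degree k = d}"
    by (auto simp: q_def in_keys_iff lookup_homogeneous_component split: if_splits)
  have m: "m \<in> Poly_Mapping.keys q" using p lead_in_keys[of p] by (simp add: keys)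
  then have "lead q = m" by (rule lead_eqI) (simp add: keys p(4) le_lead)
  moreover have "q \<noteq> 0" using m by auto
  moreover have "q \<in> I" using assms p(1) by (simp add: homogeneous_ideal_def q_def)
  moreover have "q \<in> truncation r n" using p(2) by (auto simp: truncation_def polys_def keys)
  ultimately show "m \<in> lead ` (degree_part d (I \<inter> truncation r n) - {0})"
    by (intro image_eqI[of _ _ q]) (auto simp: degree_part_def keys)
qed

lemma mpoly_dim_degree_part:
  fixes I :: "'k::field mpoly set"
  assumes "homogeneous_ideal r I"
  shows "mpoly_dim (degree_part d (I \<inter> truncation r n)) = card {m \<in> leads r n I. monom_degree m = d}"
proof -
  have I: "ideal I (mpoly_ring r)" using assms by (simp add: homogeneous_ideal_def)
  interpret I: ideal I "mpoly_ring r" by (rule I)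
  have Iadd: "p + q \<in> I" if "p \<in> I" "q \<in> I" for p q
    using additive_subgroup.a_closed[OF I.additive_subgroup_axioms that] by (simp add: mpoly_ring_def)
  have Izero: "0 \<in> I" using additive_subgroup.zero_closed[OF I.additive_subgroup_axioms] by (simp add: mpoly_ring_def)
  have Iscale: "mpoly_scale c p \<in> I" if "p \<in> I" for c p
    using I.I_l_closed[OF that, of "Const c"]
    by (simp add: mpoly_ring_def Const_in_polys mpoly_scale_def)
  have "mpoly_dim (degree_part d (I \<inter> truncation r n)) =
      card (lead ` (degree_part d (I \<inter> truncation r n) - {0}))"
  proof (rule mpoly_dim_eq_card_lead)
    show "0 \<in> degree_part d (I \<inter> truncation r n)"
      by (simp add: degree_part_def Izero truncation_def zero_in_polys)
    show "p + q \<in> degree_part d (I \<inter> truncation r n)"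
      if "p \<in> degree_part d (I \<inter> truncation r n)" "q \<in> degree_part d (I \<inter> truncation r n)" for p q
      using that Poly_Mapping.keys_add[of p q]
      by (auto simp: degree_part_def Iadd truncation_def add_in_polys)
    show "mpoly_scale c p \<in> degree_part d (I \<inter> truncation r n)"
      if "p \<in> degree_part d (I \<inter> truncation r n)" for c p
      using that keys_mpoly_scale[of c p]
      by (auto simp: degree_part_def Iscale truncation_def polys_def)
    have "finite {m. Poly_Mapping.keys m \<subseteq> {1..r} \<times> {0..n} \<and> monom_degree m = d}"
      by (rule finite_monoms_of_degree) simp
    then show "finite (lead ` (degree_part d (I \<inter> truncation r n) - {0}))"
    proof (rule rev_finite_subset, intro subsetI)
      fix m assume "m \<in> lead ` (degree_part d (I \<inter> truncation r n) - {0})"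
      then obtain p where "p \<in> degree_part d (I \<inter> truncation r n)" "m \<in> Poly_Mapping.keys p"
        using lead_in_keys by blast
      then show "m \<in> {m. Poly_Mapping.keys m \<subseteq> {1..r} \<times> {0..n} \<and> monom_degree m = d}"
        unfolding degree_part_def truncation_def polys_def by blast
    qed
  qed
  then show ?thesis by (simp add: leads_degree_part[OF assms])
qed

definition lead_words :: "nat \<Rightarrow> 'k::field mpoly set \<Rightarrow> config set" where
  "lead_words r I = {([], w) |w n. w \<in> lists {b. length b = r} \<and> length w = Suc n \<and>
     word_monom r w \<in> leads r n I}"

lemma upset_lead_words:
  assumes "homogeneous_ideal r I" "symmetric_stable I"
  shows "config_upset r 0 (lead_words r I)"
proof (rule upsetI)
  show "lead_words r I \<subseteq> configs r 0" by (auto simp: lead_words_def configs_def)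
  fix x y assume x: "x \<in> lead_words r I" and y: "y \<in> configs r 0" and le: "config_le x y"
  obtain w n where w: "x = ([], w)" "w \<in> lists {b. length b = r}" "length w = Suc n"
    "word_monom r w \<in> leads r n I" using x by (auto simp: lead_words_def)
  obtain v where v: "y = ([], v)" "v \<in> lists {b. length b = r}"
    using y by (auto simp: configs_def)
  have emb: "list_emb vec_le w v" using le by (simp add: w v)
  have "Suc n \<le> length v" using list_emb_length[OF emb] w(3) by simp
  then obtain n' where n': "length v = Suc n'" by (cases "length v") auto
  have "word_monom r v \<in> leads r n' I"
    using leads_word_upward[OF _ assms(2) w(4,3) emb n' w(2)] assms(1)
    by (simp add: homogeneous_ideal_def)
  then show "y \<in> lead_words r I" using v n' by (auto simp: lead_words_def)
qed

text \<open>
  The factor \<open>fps_s\<close> is due to \<open>I\<^sub>n\<close> involving the \<open>n + 1\<close> columns \<open>0, \<dots>, n\<close>, so that its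
  monomials are words of length \<open>n + 1\<close>.
\<close>

lemma hilbert_series_eq_config_gf:
  assumes "homogeneous_ideal r I"
  shows "fps_s * equivariant_hilbert_series r I = config_gf (lead_words r I)"
proof (rule fps_ext)
  fix n
  show "fps_nth (fps_s * equivariant_hilbert_series r I) n = fps_nth (config_gf (lead_words r I)) n"
  proof (cases n)
    case 0
    have "{x \<in> lead_words r I. config_len x = 0 \<and> config_deg x = e} = {}" for e
      by (auto simp: lead_words_def config_len_def)
    then show ?thesis by (simp add: 0 fps_s_def fps_eq_iff gen_fun_nth del: Collect_empty_eq)
  next
    case (Suc k)
    have "card {m \<in> leads r k I. monom_degree m = d} =
        card {x \<in> lead_words r I. config_len x = Suc k \<and> config_deg x = d}" (is "card ?M = card ?X") for d
    proof (rule bij_betw_same_card[symmetric])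
      show "bij_betw (\<lambda>x. word_monom r (snd x)) ?X ?M"
        unfolding bij_betw_def
      proof (intro conjI equalityI subsetI)
        show "inj_on (\<lambda>x. word_monom r (snd x)) ?X"
        proof (rule inj_onI)
          fix x y assume x: "x \<in> ?X" and y: "y \<in> ?X"
            and eq: "word_monom r (snd x) = word_monom r (snd y)"
          have "snd x = snd y"
            by (rule inj_onD[OF inj_word_monom[of r "Suc k"] eq])
              (use x y in \<open>auto simp: lead_words_def config_len_def\<close>)
          moreover have "fst x = []" "fst y = []" using x y by (auto simp: lead_words_def)
          ultimately show "x = y" by (simp add: prod_eq_iff)
        qed
      next
        fix m assume "m \<in> (\<lambda>x. word_monom r (snd x)) ` ?X"
        then obtain x where x: "x \<in> ?X" "m = word_monom r (snd x)" by blast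
        then have "snd x \<in> lists {b. length b = r}" "sum_list (map sum_list (snd x)) = d"
          "word_monom r (snd x) \<in> leads r k I"
          by (auto simp: lead_words_def config_len_def config_deg_def)
        then show "m \<in> ?M" using degree_word_monom[of "snd x" r] x(2) by simp
      next
        fix m assume m: "m \<in> ?M"
        then have "m \<in> leads r k I" by simp
        then have "Poly_Mapping.keys m \<subseteq> {1..r} \<times> {0..k}" by (rule keys_leads)
        then have "Poly_Mapping.keys m \<subseteq> {1..r} \<times> {..<Suc k}"
          by (simp add: lessThan_Suc_atMost atLeast0AtMost)
        from word_monom_surj[OF this] obtain w
          where w: "w \<in> lists {b. length b = r}" "length w = Suc k" "word_monom r w = m" .
        then have "([], w) \<in> ?X"
          using m degree_word_monom[OF w(1)]
          by (auto simp: lead_words_def config_len_def config_deg_def)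
        then show "m \<in> (\<lambda>x. word_monom r (snd x)) ` ?X"
          using w(3) by (intro image_eqI[of _ _ "([], w)"]) simp_all
      qed
    qed
    then show ?thesis
      by (simp add: Suc fps_s_def fps_eq_iff gen_fun_nth equivariant_hilbert_series_def
          hilbert_series_def mpoly_dim_degree_part[OF assms])
  qed
qed

theorem theorem1p1:
  fixes r :: nat and I :: "'k::field mpoly set"
  assumes "r \<ge> 1"
    and "homogeneous_ideal r I"
    and "symmetric_stable I"
  shows "rational_fps2 (equivariant_hilbert_series r I)"
proof (rule rational_fps2_divide)
  show "rational_fps2 (fps_s * equivariant_hilbert_series r I)"
    using rational_config_gf[OF upset_lead_words[OF assms(2,3)]] by (simp add: hilbert_series_eq_config_gf[OF assms(2)])
  show "rational_fps2 fps_s" by (rule rational_fps2_s)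
  show "fps_s \<noteq> 0" by (simp add: fps_s_def)
qed

end
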